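(* There is a linear-time algorithm (linear in the size of the instance) which, given a CL-restricted HRLQ instance that admits a feasible matching, outputs a feasible envy-free matching of maximum size among all feasible envy-free matchings (equivalently, one leaving the minimum number of residents unmatched).
   Context: An HRLQ instance is a bipartite graph $G=(\mathcal{R}\cup\mathcal{H},E)$ with residents $\mathcal{R}$ and hospitals $\mathcal{H}$; $(r,h)\in E$ means $r,h$ are mutually acceptable. Each hospital $h$ has an upper quota $q^+(h)$ and a lower quota $q^-(h)\le q^+(h)$. Every vertex ranks its neighbours in a strict order; $b_1>_a b_2$ means $a$ prefers $b_1$ to $b_2$. A matching $M\subseteq E$ assigns each resident to at most one hospital and each hospital $h$ to at most $q^+(h)$ residents; $M(r)$ is the hospital of $r$ ($M(r)=\bot$ if unmatched, $\bot$ being worst for $r$), $M(h)$ the set of residents of $h$. $M$ is feasible if $|M(h)|\ge q^-(h)$ for all $h$. A resident $r$ envies a matched resident $r'$ with $M(r')=h$, $(r,h)\in E$, if $h>_r M(r)$ and $r>_h r'$; $M$ is envy-free if no such pair exists. The instance is CL-restricted if every hospital with positive lower quota is acceptable to (and ranks) every resident, i.e. $(r,h)\in E$ for all $r\in\mathcal{R}$ and all $h$ with $q^-(h)>0$. *)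

theory Defs
  imports Main
begin

section \<open>Hospital-residents instances with lower quotas\<close>

record ('r, 'h) hrlq =
  residents :: "'r set"
  hospitals :: "'h set"
  edges :: "('r \<times> 'h) set"
  rprefers :: "'r \<Rightarrow> 'h \<Rightarrow> 'h \<Rightarrow> bool"  \<comment> \<open>\<open>rprefers I r h1 h2\<close>: \<open>r\<close> strictly prefers \<open>h1\<close> to \<open>h2\<close>\<close>
  hprefers :: "'h \<Rightarrow> 'r \<Rightarrow> 'r \<Rightarrow> bool"
  uquota :: "'h \<Rightarrow> nat"
  lquota :: "'h \<Rightarrow> nat"

definition rnbrs :: "('r, 'h) hrlq \<Rightarrow> 'r \<Rightarrow> 'h set" where
  "rnbrs I r = {h. (r, h) \<in> edges I}"

definition hnbrs :: "('r, 'h) hrlq \<Rightarrow> 'h \<Rightarrow> 'r set" where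
  "hnbrs I h = {r. (r, h) \<in> edges I}"

definition strict_linear_on :: "'a set \<Rightarrow> ('a \<Rightarrow> 'a \<Rightarrow> bool) \<Rightarrow> bool" where
  "strict_linear_on A P \<longleftrightarrow> irreflp_on A P \<and> transp_on A P \<and> totalp_on A P"

definition hrlq_instance :: "('r, 'h) hrlq \<Rightarrow> bool" where
  "hrlq_instance I \<longleftrightarrow>
     finite (residents I) \<and> finite (hospitals I) \<and>
     edges I \<subseteq> residents I \<times> hospitals I \<and>
     (\<forall>r\<in>residents I. strict_linear_on (rnbrs I r) (rprefers I r)) \<and>
     (\<forall>h\<in>hospitals I. strict_linear_on (hnbrs I h) (hprefers I h)) \<and>
     (\<forall>h\<in>hospitals I. lquota I h \<le> uquota I h)"

definition CL_restricted :: "('r, 'h) hrlq \<Rightarrow> bool" where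
  "CL_restricted I \<longleftrightarrow>
     (\<forall>h\<in>hospitals I. lquota I h > 0 \<longrightarrow> (\<forall>r\<in>residents I. (r, h) \<in> edges I))"

definition is_matching :: "('r, 'h) hrlq \<Rightarrow> ('r \<times> 'h) set \<Rightarrow> bool" where
  "is_matching I M \<longleftrightarrow>
     M \<subseteq> edges I \<and>
     (\<forall>r h h'. (r, h) \<in> M \<and> (r, h') \<in> M \<longrightarrow> h = h') \<and>
     (\<forall>h\<in>hospitals I. card {r. (r, h) \<in> M} \<le> uquota I h)"

definition is_feasible :: "('r, 'h) hrlq \<Rightarrow> ('r \<times> 'h) set \<Rightarrow> bool" where
  "is_feasible I M \<longleftrightarrow> (\<forall>h\<in>hospitals I. card {r. (r, h) \<in> M} \<ge> lquota I h)"

definition partner :: "('r \<times> 'h) set \<Rightarrow> 'r \<Rightarrow> 'h option" where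
  "partner M r = (if \<exists>h. (r, h) \<in> M then Some (THE h. (r, h) \<in> M) else None)"

definition prefers_to_partner :: "('r, 'h) hrlq \<Rightarrow> ('r \<times> 'h) set \<Rightarrow> 'r \<Rightarrow> 'h \<Rightarrow> bool" where
  "prefers_to_partner I M r h =
     (case partner M r of None \<Rightarrow> True | Some h' \<Rightarrow> rprefers I r h h')"

definition envies :: "('r, 'h) hrlq \<Rightarrow> ('r \<times> 'h) set \<Rightarrow> 'r \<Rightarrow> 'r \<Rightarrow> bool" where
  "envies I M r r' \<longleftrightarrow>
     (\<exists>h. partner M r' = Some h \<and> (r, h) \<in> edges I \<and>
          prefers_to_partner I M r h \<and> hprefers I h r r')"

definition envy_free :: "('r, 'h) hrlq \<Rightarrow> ('r \<times> 'h) set \<Rightarrow> bool" where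
  "envy_free I M \<longleftrightarrow> (\<forall>r\<in>residents I. \<forall>r'\<in>residents I. \<not> envies I M r r')"

definition feasible_ef_matching :: "('r, 'h) hrlq \<Rightarrow> ('r \<times> 'h) set \<Rightarrow> bool" where
  "feasible_ef_matching I M \<longleftrightarrow> is_matching I M \<and> is_feasible I M \<and> envy_free I M"

definition unmatched :: "('r, 'h) hrlq \<Rightarrow> ('r \<times> 'h) set \<Rightarrow> 'r set" where
  "unmatched I M = {r \<in> residents I. partner M r = None}"

definition instance_size :: "('r, 'h) hrlq \<Rightarrow> nat" where
  "instance_size I = card (residents I) + card (hospitals I) + card (edges I)"


section \<open>Word RAM programs\<close>

text \<open>
  The machine has registers and zero-initialised arrays, both named by natural numbers that
  occur literally in the program, so every program uses only finitely many of them.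
  Every assignment and every test takes one step. The semantics is parameterised
  by the largest value \<open>W\<close> that fits into a machine word: a computation that produces a
  larger value is stuck. Hence unit cost cannot be exploited by packing data into huge numbers.
\<close>

datatype test = Less nat nat | Equal nat nat

datatype com =
    Skip
  | Const nat nat      \<comment> \<open>\<open>Const x k\<close>: \<open>x := k\<close>\<close>
  | Copy nat nat       \<comment> \<open>\<open>Copy x y\<close>: \<open>x := y\<close>\<close>
  | Add nat nat nat    \<comment> \<open>\<open>Add x y z\<close>: \<open>x := y + z\<close>\<close>
  | Sub nat nat nat    \<comment> \<open>\<open>Sub x y z\<close>: \<open>x := y - z\<close>, truncated at zero\<close>
  | Load nat nat nat   \<comment> \<open>\<open>Load x a y\<close>: \<open>x := a[y]\<close>\<close>
  | Store nat nat nat  \<comment> \<open>\<open>Store a x y\<close>: \<open>a[x] := y\<close>\<close>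
  | Seq com com
  | Branch test com com
  | While test com

type_synonym state = "(nat \<Rightarrow> nat) \<times> (nat \<Rightarrow> nat \<Rightarrow> nat)"

fun holds :: "test \<Rightarrow> state \<Rightarrow> bool" where
  "holds (Less x y) (R, A) \<longleftrightarrow> R x < R y"
| "holds (Equal x y) (R, A) \<longleftrightarrow> R x = R y"

text \<open>\<open>exec W p s t s'\<close>: with largest word \<open>W\<close>, program \<open>p\<close> started in \<open>s\<close> halts in \<open>s'\<close>
  after exactly \<open>t\<close> steps.\<close>

inductive exec :: "nat \<Rightarrow> com \<Rightarrow> state \<Rightarrow> nat \<Rightarrow> state \<Rightarrow> bool" for W :: nat where
  Skip: "exec W Skip s 1 s"
| Const: "k \<le> W \<Longrightarrow> exec W (Const x k) (R, A) 1 (R(x := k), A)"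
| Copy: "exec W (Copy x y) (R, A) 1 (R(x := R y), A)"
| Add: "R y + R z \<le> W \<Longrightarrow> exec W (Add x y z) (R, A) 1 (R(x := R y + R z), A)"
| Sub: "exec W (Sub x y z) (R, A) 1 (R(x := R y - R z), A)"
| Load: "exec W (Load x a y) (R, A) 1 (R(x := A a (R y)), A)"
| Store: "exec W (Store a x y) (R, A) 1 (R, A(a := (A a)(R x := R y)))"
| Seq: "exec W p s t s' \<Longrightarrow> exec W q s' u s'' \<Longrightarrow> exec W (Seq p q) s (t + u) s''"
| BranchTrue: "holds b s \<Longrightarrow> exec W p s t s' \<Longrightarrow> exec W (Branch b p q) s (1 + t) s'"
| BranchFalse: "\<not> holds b s \<Longrightarrow> exec W q s t s' \<Longrightarrow> exec W (Branch b p q) s (1 + t) s'"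
| WhileFalse: "\<not> holds b s \<Longrightarrow> exec W (While b p) s 1 s"
| WhileTrue: "holds b s \<Longrightarrow> exec W p s t s' \<Longrightarrow> exec W (While b p) s' u s''
    \<Longrightarrow> exec W (While b p) s (1 + t + u) s''"

inductive_cases SeqE: "exec W (Seq p q) s t s'"

lemma exec_deterministic:
  "exec W p s t s' \<Longrightarrow> exec W p s u s'' \<Longrightarrow> u = t \<and> s'' = s'"
proof (induction arbitrary: u s'' rule: exec.induct)
  case (Seq p s t s1 q t' s2)
  from Seq.prems obtain v w s3 where *: "exec W p s v s3" "exec W q s3 w s''" "u = v + w"
    by (rule SeqE)
  then show ?case using Seq.IH(1)[OF *(1)] Seq.IH(2)[of w s''] by simp
next
  case (BranchTrue b s p t s' q)
  from BranchTrue.prems BranchTrue.hyps obtain v where "exec W p s v s''" "u = 1 + v"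
    by (cases rule: exec.cases) auto
  then show ?case using BranchTrue.IH[of v s''] by simp
next
  case (BranchFalse b s q t s' p)
  from BranchFalse.prems BranchFalse.hyps obtain v where "exec W q s v s''" "u = 1 + v"
    by (cases rule: exec.cases) auto
  then show ?case using BranchFalse.IH[of v s''] by simp
next
  case (WhileFalse b s p)
  from WhileFalse.prems WhileFalse.hyps show ?case
    by (cases rule: exec.cases) auto
next
  case (WhileTrue b s p t s1 t' s2)
  from WhileTrue.prems WhileTrue.hyps(1) obtain v w s3
    where *: "exec W p s v s3" "exec W (While b p) s3 w s''" "u = 1 + v + w"
    by (cases rule: exec.cases) auto
  then show ?case using WhileTrue.IH(1)[OF *(1)] WhileTrue.IH(2)[of w s''] by simp
qed (erule exec.cases; simp)+


section \<open>Input and output conventions\<close>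

definition is_pref_list :: "'a set \<Rightarrow> ('a \<Rightarrow> 'a \<Rightarrow> bool) \<Rightarrow> 'a list \<Rightarrow> bool" where
  "is_pref_list A P xs \<longleftrightarrow> distinct xs \<and> set xs = A \<and> sorted_wrt P xs"

text \<open>
  An input is a sequence of words: the numbers of residents and hospitals, the lower quotas, the
  upper quotas, then the preference list (best first) of every resident and of every hospital,
  each preceded by its length. Both sides are numbered from 0.
\<close>

definition encodes :: "nat list \<Rightarrow> (nat, nat) hrlq \<Rightarrow> bool" where
  "encodes xs I \<longleftrightarrow>
     (\<exists>n m rl hl.
        residents I = {..<n} \<and> hospitals I = {..<m} \<and>
        (\<forall>r<n. is_pref_list (rnbrs I r) (rprefers I r) (rl r)) \<and>
        (\<forall>h<m. is_pref_list (hnbrs I h) (hprefers I h) (hl h)) \<and>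
        xs = [n, m] @ map (lquota I) [0..<m] @ map (uquota I) [0..<m] @
             concat (map (\<lambda>r. length (rl r) # rl r) [0..<n]) @
             concat (map (\<lambda>h. length (hl h) # hl h) [0..<m]))"

lemma pref_list_exists:
  assumes "finite A" "strict_linear_on A P"
  shows "\<exists>xs. is_pref_list A P xs"
  using assms
proof (induction A rule: finite_induct)
  case empty
  show ?case by (rule exI[of _ "[]"]) (simp add: is_pref_list_def)
next
  case (insert x A)
  have lin: "irreflp_on (insert x A) P" "transp_on (insert x A) P" "totalp_on (insert x A) P"
    using insert.prems by (auto simp: strict_linear_on_def)
  have "strict_linear_on A P"
    using lin unfolding strict_linear_on_def
    by (meson irreflp_on_subset subset_insertI totalp_on_subset transp_on_subset)
  then obtain xs where xs: "distinct xs" "set xs = A" "sorted_wrt P xs"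
    using insert.IH by (auto simp: is_pref_list_def)
  have tr: "P a c" if "P a b" "P b c" "a \<in> insert x A" "b \<in> insert x A" "c \<in> insert x A" for a b c
    using transp_onD[OF lin(2) that(3,4,5)] that(1,2) by blast
  have ir: "\<not> P a a" if "a \<in> insert x A" for a
    using irreflp_onD[OF lin(1) that] .
  have tot: "P y x \<or> P x y" if "y \<in> A" for y
    using totalp_onD[OF lin(3), of y x] that insert.hyps by auto
  let ?ys = "filter (\<lambda>y. P y x) xs @ x # filter (\<lambda>y. P x y) xs"
  have "{y \<in> A. P y x} \<inter> {y \<in> A. P x y} = {}"
    using tr[of x _ x] ir[of x] by blast
  then have "distinct ?ys"
    using xs(1,2) insert.hyps(2) by auto
  moreover have "set ?ys = insert x A"
    using xs tot by auto
  moreover have "sorted_wrt P ?ys"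
    unfolding sorted_wrt_append
  proof (intro conjI ballI)
    show "sorted_wrt P (filter (\<lambda>y. P y x) xs)"
      by (rule sorted_wrt_filter[OF xs(3)])
    show "sorted_wrt P (x # filter (\<lambda>y. P x y) xs)"
      using sorted_wrt_filter[OF xs(3)] by simp
    fix a b assume a: "a \<in> set (filter (\<lambda>y. P y x) xs)"
      and b: "b \<in> set (x # filter (\<lambda>y. P x y) xs)"
    show "P a b"
    proof (cases "b = x")
      case False
      then show ?thesis using a b xs(2) by (intro tr[of a x b]) auto
    qed (use a in simp)
  qed
  ultimately show ?case unfolding is_pref_list_def by blast
qed

lemma encoding_exists:
  fixes I :: "(nat, nat) hrlq"
  assumes I: "hrlq_instance I" and R: "residents I = {..<n}" and H: "hospitals I = {..<m}"
  shows "\<exists>xs. encodes xs I"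
proof -
  have E: "edges I \<subseteq> {..<n} \<times> {..<m}"
    using I R H by (simp add: hrlq_instance_def)
  have "finite (rnbrs I r)" for r
    by (rule finite_subset[of _ "{..<m}"]) (use E in \<open>auto simp: rnbrs_def\<close>)
  then have "\<forall>r<n. \<exists>l. is_pref_list (rnbrs I r) (rprefers I r) l"
    using I R by (auto simp: hrlq_instance_def intro!: pref_list_exists)
  then obtain rl where "\<forall>r<n. is_pref_list (rnbrs I r) (rprefers I r) (rl r)" by metis
  moreover have "finite (hnbrs I h)" for h
    by (rule finite_subset[of _ "{..<n}"]) (use E in \<open>auto simp: hnbrs_def\<close>)
  then have "\<forall>h<m. \<exists>l. is_pref_list (hnbrs I h) (hprefers I h) l"
    using I H by (auto simp: hrlq_instance_def intro!: pref_list_exists)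
  then obtain hl where "\<forall>h<m. is_pref_list (hnbrs I h) (hprefers I h) (hl h)" by metis
  ultimately show ?thesis
    unfolding encodes_def using R H by blast
qed

definition input_state :: "nat list \<Rightarrow> state" where
  "input_state xs = ((\<lambda>_. 0), (\<lambda>a i. if a = 0 \<and> i < length xs then xs ! i else 0))"

text \<open>The result is read off array 1: its entry at \<open>r\<close> is 0 if \<open>r\<close> is unmatched, and \<open>h + 1\<close> if
  \<open>r\<close> is assigned to \<open>h\<close>.\<close>

definition output_matching :: "(nat, nat) hrlq \<Rightarrow> state \<Rightarrow> (nat \<times> nat) set" where
  "output_matching I s = {(r, h). r \<in> residents I \<and> snd s 1 r = Suc h}"

text \<open>Machine words hold values up to a constant multiple of the size of the instance plus the
  largest number in the input, i.e. the word length is logarithmic. The summand 1 in both bounds is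
  needed only for the instance without vertices, whose size is 0.\<close>

definition computes_within :: "nat \<Rightarrow> com \<Rightarrow> (nat, nat) hrlq \<Rightarrow> nat list \<Rightarrow> (nat \<times> nat) set \<Rightarrow> bool"
  where
  "computes_within c p I xs M \<longleftrightarrow>
     (\<exists>t s. exec (c * (instance_size I + Max (set xs) + 1)) p (input_state xs) t s \<and>
            t \<le> c * (instance_size I + 1) \<and>
            M = output_matching I s)"

end

theory Submission
  imports Defs
begin

text \<open>
  If every hospital admits a prefix of its preference list and every resident takes the best
  hospital admitting him, the result is envy-free. Starting from full lists, residents apply one
  after the other in the manner of deferred acceptance, and the prefixes shrink. Let \<open>b\<close> be the total
  number of assignments above the lower quotas. An application to \<open>h\<close> occupies a new seat if \<open>h\<close> is
  below its lower quota, or if \<open>h\<close> is below its upper quota and \<open>b < |R| - \<Sum> q\<^sup>-\<close>; otherwise the prefix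
  of \<open>h\<close> shrinks by one. Hence occupied seats are never given up, and \<open>h\<close> turns someone away only after
  its lower quota is met.

  If some \<open>h\<close> ended below its lower quota, its list would be full; as \<open>h\<close> is acceptable to all, all
  residents would be matched, which contradicts the bound on \<open>b\<close>. So the result is feasible. If \<open>b\<close>
  reaches its bound, all residents are matched. Otherwise only hospitals at their upper quota have
  turned someone away, so the matching is stable with respect to the upper quotas, and every resident
  matched in some envy-free matching is matched in it.

  For linear time, the position of \<open>r\<close> in the list of \<open>h\<close> has to be available at the position of \<open>h\<close> in
  the list of \<open>r\<close>. These cross references are computed by bucketing all hospital list entries by
  resident.
\<close>

section \<open>Envy-free and stable matchings\<close>

lemma partner_eq_Some:
  assumes "is_matching I M"
  shows "partner M r = Some h \<longleftrightarrow> (r, h) \<in> M"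
proof -
  have "(THE h'. (r, h') \<in> M) = h" if "(r, h) \<in> M" for h
    using that assms by (intro the_equality) (auto simp: is_matching_def)
  then show ?thesis by (auto simp: partner_def)
qed

lemma partner_eq_None: "partner M r = None \<longleftrightarrow> r \<notin> fst ` M"
  by (force simp: partner_def)

lemma card_fst_matching:
  assumes "is_matching I M"
  shows "card (fst ` M) = card M"
  using assms by (intro card_image) (auto simp: inj_on_def is_matching_def)

lemma matched_subset_stable:
  assumes I: "hrlq_instance I" and M: "is_matching I M"
    and M': "is_matching I M'" and ef: "envy_free I M'"
    and stable: "\<And>r h. (r, h) \<in> edges I \<Longrightarrow> prefers_to_partner I M r h \<Longrightarrow>
      card {z. (z, h) \<in> M} = uquota I h \<and> (\<forall>z. (z, h) \<in> M \<longrightarrow> hprefers I h z r)"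
  shows "fst ` M' \<subseteq> fst ` M"
proof -
  define S where "S = {(r, h) \<in> M'. prefers_to_partner I M r h}"
  define H where "H = snd ` S"
  define N where "N h = {r. (r, h) \<in> M}" for h
  define N' where "N' h = {r. (r, h) \<in> M'}" for h
  have sub: "M \<subseteq> edges I" "M' \<subseteq> edges I" and E: "edges I \<subseteq> residents I \<times> hospitals I"
    and fin: "finite (residents I)" "finite (hospitals I)"
    using I M M' by (auto simp: hrlq_instance_def is_matching_def)
  have HH: "H \<subseteq> hospitals I" using sub E by (auto simp: H_def S_def)
  then have finH: "finite H" using fin(2) finite_subset by blast
  have finN: "finite (N h)" "finite (N' h)" for h
    using sub E fin(1) by (auto simp: N_def N'_def intro: finite_subset[of _ "residents I"])
  have "z \<in> (\<Union>h\<in>H. N' h)" if h: "h \<in> H" and z: "z \<in> N h" for z h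
  proof -
    obtain r where r: "(r, h) \<in> M'" "prefers_to_partner I M r h"
      using h by (auto simp: H_def S_def)
    have zh: "(z, h) \<in> M" using z by (simp add: N_def)
    have "hprefers I h z r" using stable[of r h] r sub zh by blast
    moreover have "\<not> envies I M' z r"
      using ef sub E zh r(1) unfolding envy_free_def by blast
    ultimately have "\<not> prefers_to_partner I M' z h"
      using r(1) zh sub partner_eq_Some[OF M'] unfolding envies_def by blast
    then obtain h' where h': "(z, h') \<in> M'" "\<not> rprefers I z h h'"
      using partner_eq_Some[OF M'] by (auto simp: prefers_to_partner_def split: option.splits)
    have "totalp_on (rnbrs I z) (rprefers I z)"
      using I zh sub E unfolding hrlq_instance_def strict_linear_on_def by blast
    then have "h' = h \<or> rprefers I z h' h"
      using h' zh sub unfolding totalp_on_def rnbrs_def by blast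
    then show ?thesis
    proof
      assume "h' = h" then show ?thesis using h h' by (auto simp: N'_def)
    next
      assume "rprefers I z h' h"
      then have "prefers_to_partner I M z h'"
        using partner_eq_Some[OF M, of z h] zh by (simp add: prefers_to_partner_def)
      then have "h' \<in> H" using h' by (force simp: H_def S_def)
      then show ?thesis using h' by (auto simp: N'_def)
    qed
  qed
  then have sub': "(\<Union>h\<in>H. N h) \<subseteq> (\<Union>h\<in>H. N' h)" by blast
  have "card (\<Union>h\<in>H. N h) = (\<Sum>h\<in>H. card (N h))"
    using finH finN M by (intro card_UN_disjoint) (auto simp: N_def is_matching_def)
  moreover have "card (\<Union>h\<in>H. N' h) = (\<Sum>h\<in>H. card (N' h))"
    using finH finN M' by (intro card_UN_disjoint) (auto simp: N'_def is_matching_def)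
  moreover have "(\<Sum>h\<in>H. card (N' h)) \<le> (\<Sum>h\<in>H. card (N h))"
  proof (rule sum_mono)
    fix h assume h: "h \<in> H"
    then obtain r where "(r, h) \<in> M'" "prefers_to_partner I M r h"
      by (auto simp: H_def S_def)
    then have "card (N h) = uquota I h" using stable[of r h] sub by (auto simp: N_def)
    moreover have "card (N' h) \<le> uquota I h"
      using h HH M' by (auto simp: is_matching_def N'_def)
    ultimately show "card (N' h) \<le> card (N h)" by simp
  qed
  ultimately have eq: "(\<Union>h\<in>H. N h) = (\<Union>h\<in>H. N' h)"
    using sub' finH finN by (intro card_seteq) auto
  show ?thesis
  proof
    fix r assume "r \<in> fst ` M'"
    then obtain h where h: "(r, h) \<in> M'" by auto
    show "r \<in> fst ` M"
    proof (rule ccontr)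
      assume "r \<notin> fst ` M"
      then have "prefers_to_partner I M r h"
        using partner_eq_None[of M r] by (simp add: prefers_to_partner_def)
      then have "h \<in> H" using h by (force simp: H_def S_def)
      then have "r \<in> (\<Union>h\<in>H. N h)" using h eq by (auto simp: N'_def)
      then show False using \<open>r \<notin> fst ` M\<close> by (force simp: N_def)
    qed
  qed
qed

section \<open>Verification of programs with a step budget\<close>

text \<open>The postcondition may refer to the number of steps left over from the budget \<open>k\<close>.\<close>

definition wp :: "nat \<Rightarrow> com \<Rightarrow> (nat \<Rightarrow> (nat \<Rightarrow> nat) \<Rightarrow> (nat \<Rightarrow> nat \<Rightarrow> nat) \<Rightarrow> bool) \<Rightarrow>
    nat \<Rightarrow> (nat \<Rightarrow> nat) \<Rightarrow> (nat \<Rightarrow> nat \<Rightarrow> nat) \<Rightarrow> bool" where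
  "wp W p Q k R A \<longleftrightarrow> (\<exists>t R' A'. exec W p (R, A) t (R', A') \<and> t \<le> k \<and> Q (k - t) R' A')"

inductive_cases execE:
  "exec W Skip s t s'" "exec W (Const x v) s t s'" "exec W (Copy x y) s t s'"
  "exec W (Add x y z) s t s'" "exec W (Sub x y z) s t s'" "exec W (Load x a y) s t s'"
  "exec W (Store a x y) s t s'" "exec W (Branch b p q) s t s'"

lemma wp_atomic [simp]:
  "wp W Skip Q k R A \<longleftrightarrow> 1 \<le> k \<and> Q (k - 1) R A"
  "wp W (Const x v) Q k R A \<longleftrightarrow> v \<le> W \<and> 1 \<le> k \<and> Q (k - 1) (R(x := v)) A"
  "wp W (Copy x y) Q k R A \<longleftrightarrow> 1 \<le> k \<and> Q (k - 1) (R(x := R y)) A"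
  "wp W (Add x y z) Q k R A \<longleftrightarrow> R y + R z \<le> W \<and> 1 \<le> k \<and> Q (k - 1) (R(x := R y + R z)) A"
  "wp W (Sub x y z) Q k R A \<longleftrightarrow> 1 \<le> k \<and> Q (k - 1) (R(x := R y - R z)) A"
  "wp W (Load x a y) Q k R A \<longleftrightarrow> 1 \<le> k \<and> Q (k - 1) (R(x := A a (R y))) A"
  "wp W (Store a x y) Q k R A \<longleftrightarrow> 1 \<le> k \<and> Q (k - 1) R (A(a := (A a)(R x := R y)))"
  unfolding wp_def by (auto elim!: execE intro: exec.intros) (metis One_nat_def exec.intros)+

lemma wp_Seq [simp]: "wp W (Seq p q) Q k R A \<longleftrightarrow> wp W p (wp W q Q) k R A"
proof
  assume "wp W (Seq p q) Q k R A"
  then obtain t R' A' where *: "exec W (Seq p q) (R, A) t (R', A')" "t \<le> k" "Q (k - t) R' A'"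
    unfolding wp_def by blast
  from *(1) obtain u v R1 A1 where
    "exec W p (R, A) u (R1, A1)" "exec W q (R1, A1) v (R', A')" "t = u + v"
    by (auto elim!: SeqE)
  then show "wp W p (wp W q Q) k R A"
    unfolding wp_def using *(2,3) by (intro exI conjI) (assumption | simp add: diff_diff_left)+
next
  assume "wp W p (wp W q Q) k R A"
  then obtain u v R1 A1 R' A' where
    *: "exec W p (R, A) u (R1, A1)" "exec W q (R1, A1) v (R', A')" "u \<le> k" "v \<le> k - u"
      "Q (k - u - v) R' A'"
    unfolding wp_def by blast
  show "wp W (Seq p q) Q k R A"
    unfolding wp_def using exec.Seq[OF *(1,2)] *(3,4,5)
    by (intro exI conjI) (assumption | simp add: diff_diff_left)+
qed

lemma wp_Branch [simp]:
  "wp W (Branch b p q) Q k R A \<longleftrightarrow>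
     1 \<le> k \<and> (if holds b (R, A) then wp W p Q (k - 1) R A else wp W q Q (k - 1) R A)"
proof
  assume "wp W (Branch b p q) Q k R A"
  then show "1 \<le> k \<and> (if holds b (R, A) then wp W p Q (k - 1) R A else wp W q Q (k - 1) R A)"
    unfolding wp_def by (force elim!: execE)
next
  assume *: "1 \<le> k \<and> (if holds b (R, A) then wp W p Q (k - 1) R A else wp W q Q (k - 1) R A)"
  then obtain t R' A' where t: "exec W (if holds b (R, A) then p else q) (R, A) t (R', A')"
    "t \<le> k - 1" "Q (k - 1 - t) R' A'"
    unfolding wp_def by (auto split: if_splits)
  then have "exec W (Branch b p q) (R, A) (1 + t) (R', A')"
    using exec.BranchTrue[of b "(R, A)"] exec.BranchFalse[of b "(R, A)"]
    by (cases "holds b (R, A)") auto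
  moreover have "1 + t \<le> k" "Q (k - (1 + t)) R' A'" using t(2,3) * by auto
  ultimately show "wp W (Branch b p q) Q k R A" unfolding wp_def by blast
qed

lemma wp_mono:
  "wp W p P k R A \<Longrightarrow> (\<And>k R A. P k R A \<Longrightarrow> Q k R A) \<Longrightarrow> wp W p Q k R A"
  unfolding wp_def by blast

text \<open>No variant is needed: every test of the guard consumes one of the remaining \<open>k\<close> steps.\<close>

lemma wp_While:
  assumes "Inv k R A"
    and "\<And>k R A. Inv k R A \<Longrightarrow> 1 \<le> k"
    and "\<And>k R A. Inv k R A \<Longrightarrow> holds b (R, A) \<Longrightarrow> wp W p Inv (k - 1) R A"
    and "\<And>k R A. Inv k R A \<Longrightarrow> \<not> holds b (R, A) \<Longrightarrow> Q (k - 1) R A"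
  shows "wp W (While b p) Q k R A"
  using assms(1)
proof (induction k arbitrary: R A rule: less_induct)
  case (less k)
  have k: "1 \<le> k" using assms(2) less.prems .
  show ?case
  proof (cases "holds b (R, A)")
    case True
    then obtain t R1 A1 where t: "exec W p (R, A) t (R1, A1)" "t \<le> k - 1" "Inv (k - 1 - t) R1 A1"
      using assms(3)[OF less.prems] unfolding wp_def by blast
    then have "wp W (While b p) Q (k - 1 - t) R1 A1"
      using k by (intro less.IH) auto
    then obtain u R2 A2 where u: "exec W (While b p) (R1, A1) u (R2, A2)" "u \<le> k - 1 - t"
      "Q (k - 1 - t - u) R2 A2"
      unfolding wp_def by blast
    have "k - (1 + t + u) = k - 1 - t - u" by simp
    then show ?thesis
      unfolding wp_def using exec.WhileTrue[OF True t(1) u(1)] t(2) u k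
      by (intro exI[of _ "1 + t + u"] exI conjI) (assumption | simp)+
  next
    case False
    then show ?thesis
      unfolding wp_def using exec.WhileFalse[of b "(R, A)"] assms(4)[OF less.prems] k by blast
  qed
qed

lemma wp_conseq:
  assumes "wp W p (\<lambda>_. P) c R A" "c \<le> k"
    and "\<And>k' R' A'. P R' A' \<Longrightarrow> k \<le> k' + c \<Longrightarrow> Q k' R' A'"
  shows "wp W p Q k R A"
proof -
  from assms(1) obtain t R' A' where t: "exec W p (R, A) t (R', A')" "t \<le> c" "P R' A'"
    unfolding wp_def by blast
  moreover have "Q (k - t) R' A'" using t assms(2) by (intro assms(3)) auto
  ultimately show ?thesis unfolding wp_def using assms(2) le_trans by blast
qed

section \<open>Memory layout of an encoded instance\<close>

lemma length_concat_blocks: "length (concat (map b [0..<n])) = (\<Sum>j<n. length (b j))"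
  by (induction n) auto

lemma nth_concat_blocks:
  assumes "r < n" "i < length (b r)"
  shows "concat (map b [0..<n]) ! ((\<Sum>j<r. length (b j)) + i) = b r ! i"
  using assms(1)
proof (induction n)
  case (Suc n)
  show ?case
  proof (cases "r = n")
    case True
    then show ?thesis using length_concat_blocks[of b n] assms(2) by (simp add: nth_append)
  next
    case False
    then have "r < n" using Suc.prems by simp
    then have "(\<Sum>j<Suc r. length (b j)) \<le> (\<Sum>j<n. length (b j))" by (intro sum_mono2) auto
    then have "(\<Sum>j<r. length (b j)) + i < length (concat (map b [0..<n]))"
      using length_concat_blocks[of b n] assms(2) by simp
    then show ?thesis using Suc.IH[OF \<open>r < n\<close>] by (simp add: nth_append)
  qed
qed simp

locale encoded =
  fixes I :: "(nat, nat) hrlq" and xs :: "nat list" and n m :: nat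
    and rl hl :: "nat \<Rightarrow> nat list"
  assumes inst: "hrlq_instance I" and CL: "CL_restricted I"
    and feasible: "\<exists>M. is_matching I M \<and> is_feasible I M"
    and residents: "residents I = {..<n}" and hospitals: "hospitals I = {..<m}"
    and rl: "r < n \<Longrightarrow> is_pref_list (rnbrs I r) (rprefers I r) (rl r)"
    and hl: "h < m \<Longrightarrow> is_pref_list (hnbrs I h) (hprefers I h) (hl h)"
    and xs: "xs = [n, m] @ map (lquota I) [0..<m] @ map (uquota I) [0..<m] @
             concat (map (\<lambda>r. length (rl r) # rl r) [0..<n]) @
             concat (map (\<lambda>h. length (hl h) # hl h) [0..<m])"
begin

definition inp :: "nat \<Rightarrow> nat" where
  "inp i = (if i < length xs then xs ! i else 0)"

text \<open>The list of resident \<open>r\<close> occupies the addresses from \<open>rs r\<close> up to but excluding \<open>re r\<close>, and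
  its length is stored just before it; \<open>hs\<close> and \<open>he\<close> delimit the lists of the hospitals.\<close>

definition rs :: "nat \<Rightarrow> nat" where "rs r = 2 * m + 3 + (\<Sum>j<r. Suc (length (rl j)))"
definition re :: "nat \<Rightarrow> nat" where "re r = rs r + length (rl r)"
definition hs :: "nat \<Rightarrow> nat" where "hs h = rs n + (\<Sum>j<h. Suc (length (hl j)))"
definition he :: "nat \<Rightarrow> nat" where "he h = hs h + length (hl h)"

lemma rs_0: "rs 0 = 2 * m + 3" and rs_Suc: "rs (Suc r) = Suc (re r)"
  and hs_0: "hs 0 = rs n" and hs_Suc: "hs (Suc h) = Suc (he h)"
  by (simp_all add: rs_def re_def hs_def he_def)

lemma rs_le_re: "rs r \<le> re r" and hs_le_he: "hs h \<le> he h"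
  by (simp_all add: re_def he_def)

lemma rs_mono: "r \<le> r' \<Longrightarrow> rs r \<le> rs r'" and hs_mono: "h \<le> h' \<Longrightarrow> hs h \<le> hs h'"
  by (auto simp: rs_def hs_def intro: sum_mono2)

lemma re_less: "r < r' \<Longrightarrow> re r < rs r'"
  using rs_mono[of "Suc r" r'] by (simp add: rs_Suc)

lemma he_less: "h < h' \<Longrightarrow> he h < hs h'"
  using hs_mono[of "Suc h" h'] by (simp add: hs_Suc)

lemma rs_gt: "2 < rs r" and hs_gt: "2 < hs h"
  by (simp_all add: rs_def hs_def)

lemma length_xs: "Suc (length xs) = hs m"
  by (simp add: xs length_concat_blocks hs_def rs_def)

lemma he_le_length: "h < m \<Longrightarrow> he h \<le> length xs"
  using hs_mono[of "Suc h" m] length_xs by (simp add: hs_Suc)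

lemma re_le_length: "r < n \<Longrightarrow> re r \<le> length xs"
  using rs_mono[of "Suc r" n] hs_mono[of 0 m] length_xs by (simp add: rs_Suc hs_0)

lemma inp_segment:
  assumes "xs = a @ b @ c" "i < length b"
  shows "inp (length a + i) = b ! i"
proof -
  have "length a + i < length xs" using assms by simp
  then have "inp (length a + i) = xs ! (length a + i)" by (simp add: inp_def)
  also have "\<dots> = b ! i" using assms(2) unfolding assms(1) by (simp add: nth_append)
  finally show ?thesis .
qed

lemma inp_0: "inp 0 = n" and inp_1: "inp (Suc 0) = m"
  using inp_segment[of "[]" "[n, m]" _ 0] inp_segment[of "[]" "[n, m]" _ 1] xs by simp_all

lemma inp_lquota: "h < m \<Longrightarrow> inp (2 + h) = lquota I h"
  using inp_segment[of "[n, m]" "map (lquota I) [0..<m]" _ h] xs by simp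

lemma inp_uquota: "h < m \<Longrightarrow> inp (2 + m + h) = uquota I h"
  using inp_segment[of "[n, m] @ map (lquota I) [0..<m]" "map (uquota I) [0..<m]" _ h] xs by simp

lemma inp_resident_block:
  assumes "r < n" "i \<le> length (rl r)"
  shows "inp (rs r - 1 + i) = (length (rl r) # rl r) ! i"
proof -
  let ?b = "\<lambda>r. length (rl r) # rl r"
  let ?c = "concat (map ?b [0..<n])"
  have len: "length ?c = (\<Sum>j<n. Suc (length (rl j)))" by (simp add: length_concat_blocks)
  have "(\<Sum>j<Suc r. Suc (length (rl j))) \<le> (\<Sum>j<n. Suc (length (rl j)))"
    using assms(1) by (intro sum_mono2) auto
  then have lt: "(\<Sum>j<r. Suc (length (rl j))) + i < length ?c" using assms(2) len by simp
  have addr: "rs r - 1 + i = length ([n, m] @ map (lquota I) [0..<m] @ map (uquota I) [0..<m])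
      + ((\<Sum>j<r. Suc (length (rl j))) + i)"
    by (simp add: rs_def)
  have x: "xs = ([n, m] @ map (lquota I) [0..<m] @ map (uquota I) [0..<m]) @ ?c @
      concat (map (\<lambda>h. length (hl h) # hl h) [0..<m])"
    by (simp add: xs)
  have "inp (rs r - 1 + i) = ?c ! ((\<Sum>j<r. Suc (length (rl j))) + i)"
    unfolding addr by (rule inp_segment[OF x lt])
  also have "\<dots> = ?b r ! i" using nth_concat_blocks[of r n i ?b] assms by simp
  finally show ?thesis .
qed

lemma inp_hospital_block:
  assumes "h < m" "i \<le> length (hl h)"
  shows "inp (hs h - 1 + i) = (length (hl h) # hl h) ! i"
proof -
  let ?b = "\<lambda>h. length (hl h) # hl h"
  let ?c = "concat (map ?b [0..<m])"
  let ?p = "[n, m] @ map (lquota I) [0..<m] @ map (uquota I) [0..<m] @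
             concat (map (\<lambda>r. length (rl r) # rl r) [0..<n])"
  have len: "length ?c = (\<Sum>j<m. Suc (length (hl j)))" by (simp add: length_concat_blocks)
  have "(\<Sum>j<Suc h. Suc (length (hl j))) \<le> (\<Sum>j<m. Suc (length (hl j)))"
    using assms(1) by (intro sum_mono2) auto
  then have lt: "(\<Sum>j<h. Suc (length (hl j))) + i < length ?c" using assms(2) len by simp
  have addr: "hs h - 1 + i = length ?p + ((\<Sum>j<h. Suc (length (hl j))) + i)"
    by (simp add: hs_def rs_def length_concat_blocks)
  have x: "xs = ?p @ ?c" by (simp add: xs)
  have "inp (hs h - 1 + i) = ?c ! ((\<Sum>j<h. Suc (length (hl j))) + i)"
    unfolding addr using inp_segment[of ?p ?c "[]", OF _ lt] x by simp
  also have "\<dots> = ?b h ! i" using nth_concat_blocks[of h m i ?b] assms by simp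
  finally show ?thesis .
qed

lemma inp_resident_length: "r < n \<Longrightarrow> inp (rs r - 1) = length (rl r)"
  using inp_resident_block[of r 0] by simp

lemma inp_hospital_length: "h < m \<Longrightarrow> inp (hs h - 1) = length (hl h)"
  using inp_hospital_block[of h 0] by simp

lemma inp_resident:
  assumes "r < n" "rs r \<le> f" "f < re r"
  shows "inp f = rl r ! (f - rs r)"
  using inp_resident_block[of r "Suc (f - rs r)"] assms rs_gt[of r] by (simp add: re_def)

lemma inp_hospital:
  assumes "h < m" "hs h \<le> e" "e < he h"
  shows "inp e = hl h ! (e - hs h)"
  using inp_hospital_block[of h "Suc (e - hs h)"] assms hs_gt[of h] by (simp add: he_def)

lemma edges_bounds: "(r, h) \<in> edges I \<Longrightarrow> r < n \<and> h < m"
  using inst residents hospitals by (auto simp: hrlq_instance_def)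

lemma resident_entry_edge:
  assumes "r < n" "rs r \<le> f" "f < re r"
  shows "(r, inp f) \<in> edges I"
proof -
  have "f - rs r < length (rl r)" using assms by (simp add: re_def)
  then have "inp f \<in> set (rl r)" using inp_resident[OF assms] by simp
  then show ?thesis using rl[OF assms(1)] by (auto simp: is_pref_list_def rnbrs_def)
qed

lemma hospital_entry_edge:
  assumes "h < m" "hs h \<le> e" "e < he h"
  shows "(inp e, h) \<in> edges I"
proof -
  have "e - hs h < length (hl h)" using assms by (simp add: he_def)
  then have "inp e \<in> set (hl h)" using inp_hospital[OF assms] by simp
  then show ?thesis using hl[OF assms(1)] by (auto simp: is_pref_list_def hnbrs_def)
qed

lemma edge_resident_entry:
  assumes "(r, h) \<in> edges I"
  obtains f where "rs r \<le> f" "f < re r" "inp f = h"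
proof -
  have r: "r < n" using edges_bounds[OF assms] by simp
  then have "h \<in> set (rl r)" using rl[OF r] assms by (auto simp: is_pref_list_def rnbrs_def)
  then obtain j where "j < length (rl r)" "rl r ! j = h" by (auto simp: in_set_conv_nth)
  then show ?thesis using that[of "rs r + j"] inp_resident[OF r, of "rs r + j"] by (simp add: re_def)
qed

lemma edge_hospital_entry:
  assumes "(r, h) \<in> edges I"
  obtains e where "hs h \<le> e" "e < he h" "inp e = r"
proof -
  have h: "h < m" using edges_bounds[OF assms] by simp
  then have "r \<in> set (hl h)" using hl[OF h] assms by (auto simp: is_pref_list_def hnbrs_def)
  then obtain j where "j < length (hl h)" "hl h ! j = r" by (auto simp: in_set_conv_nth)
  then show ?thesis using that[of "hs h + j"] inp_hospital[OF h, of "hs h + j"] by (simp add: he_def)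
qed

lemma resident_entries_sorted:
  assumes "r < n" "rs r \<le> f" "f < g" "g < re r"
  shows "rprefers I r (inp f) (inp g)"
proof -
  have "sorted_wrt (rprefers I r) (rl r)" using rl[OF assms(1)] by (simp add: is_pref_list_def)
  moreover have "f - rs r < g - rs r" "g - rs r < length (rl r)" using assms by (auto simp: re_def)
  ultimately show ?thesis
    using inp_resident[of r f] inp_resident[of r g] assms by (auto simp: sorted_wrt_iff_nth_less)
qed

lemma hospital_entries_sorted:
  assumes "h < m" "hs h \<le> f" "f < g" "g < he h"
  shows "hprefers I h (inp f) (inp g)"
proof -
  have "sorted_wrt (hprefers I h) (hl h)" using hl[OF assms(1)] by (simp add: is_pref_list_def)
  moreover have "f - hs h < g - hs h" "g - hs h < length (hl h)" using assms by (auto simp: he_def)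
  ultimately show ?thesis
    using inp_hospital[of h f] inp_hospital[of h g] assms by (auto simp: sorted_wrt_iff_nth_less)
qed

lemma rprefers_asym:
  assumes "(r, h) \<in> edges I" "(r, h') \<in> edges I" "rprefers I r h h'"
  shows "\<not> rprefers I r h' h" "h \<noteq> h'"
proof -
  have "strict_linear_on (rnbrs I r) (rprefers I r)"
    using inst edges_bounds[OF assms(1)] residents by (auto simp: hrlq_instance_def)
  then show "\<not> rprefers I r h' h" "h \<noteq> h'"
    using assms unfolding strict_linear_on_def rnbrs_def irreflp_on_def transp_on_def by blast+
qed

lemma hprefers_asym:
  assumes "(r, h) \<in> edges I" "(r', h) \<in> edges I" "hprefers I h r r'"
  shows "\<not> hprefers I h r' r" "r \<noteq> r'"
proof -
  have "strict_linear_on (hnbrs I h) (hprefers I h)"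
    using inst edges_bounds[OF assms(1)] hospitals by (auto simp: hrlq_instance_def)
  then show "\<not> hprefers I h r' r" "r \<noteq> r'"
    using assms unfolding strict_linear_on_def hnbrs_def irreflp_on_def transp_on_def by blast+
qed

definition is_rank :: "nat \<Rightarrow> nat \<Rightarrow> nat \<Rightarrow> bool" where
  "is_rank r h e \<longleftrightarrow> h < m \<and> hs h \<le> e \<and> e < he h \<and> inp e = r"

lemma is_rank_edge: "is_rank r h e \<Longrightarrow> (r, h) \<in> edges I"
  using hospital_entry_edge by (auto simp: is_rank_def)

lemma is_rank_less:
  assumes "is_rank r h e" "is_rank r' h e'" "e < e'"
  shows "hprefers I h r r'"
  using hospital_entries_sorted[of h e e'] assms by (simp add: is_rank_def)

lemma is_rank_unique:
  assumes "is_rank r h e" "is_rank r h e'"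
  shows "e = e'"
  using is_rank_less[of r h e r e'] is_rank_less[of r h e' r e] assms
    hprefers_asym(2)[of r h r] is_rank_edge by (metis linorder_neqE_nat)

lemma is_rank_hospital_unique:
  assumes "is_rank r h e" "is_rank r' h' e"
  shows "h = h'"
proof (rule ccontr)
  assume "h \<noteq> h'"
  then consider "h < h'" | "h' < h" by linarith
  then show False using he_less[of h h'] he_less[of h' h] assms by cases (auto simp: is_rank_def)
qed

definition rank :: "nat \<Rightarrow> nat \<Rightarrow> nat" where
  "rank r h = (THE e. is_rank r h e)"

lemma is_rank_rank:
  assumes "(r, h) \<in> edges I"
  shows "is_rank r h (rank r h)"
proof -
  obtain e where "is_rank r h e"
    using edge_hospital_entry[OF assms] edges_bounds[OF assms] by (auto simp: is_rank_def)
  then show ?thesis unfolding rank_def using is_rank_unique by (metis theI)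
qed

lemma rank_eq: "is_rank r h e \<Longrightarrow> rank r h = e"
  using is_rank_rank is_rank_edge is_rank_unique by blast

lemma rank_mono:
  assumes "(r, h) \<in> edges I" "(r', h) \<in> edges I" "hprefers I h r r'"
  shows "rank r h < rank r' h"
proof (rule ccontr)
  assume "\<not> rank r h < rank r' h"
  then consider "rank r' h < rank r h" | "rank r h = rank r' h" by linarith
  then show False
  proof cases
    case 1
    then show ?thesis
      using is_rank_less[OF is_rank_rank is_rank_rank] assms hprefers_asym by blast
  next
    case 2
    then show ?thesis
      using is_rank_rank[OF assms(1)] is_rank_rank[OF assms(2)] hprefers_asym(2)[OF assms]
      by (auto simp: is_rank_def)
  qed
qed

lemma sum_resident_lists: "(\<Sum>r<n. length (rl r)) = card (edges I)"
proof -
  have "length (rl r) = card (rnbrs I r)" if "r < n" for r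
    using rl[OF that] distinct_card by (metis is_pref_list_def)
  moreover have fin: "finite (rnbrs I r)" for r
    using finite_subset[of "rnbrs I r" "{..<m}"] edges_bounds by (auto simp: rnbrs_def)
  moreover have "edges I = Sigma {..<n} (rnbrs I)"
    using edges_bounds by (auto simp: rnbrs_def)
  ultimately show ?thesis by (simp add: card_SigmaI)
qed

lemma sum_hospital_lists: "(\<Sum>h<m. length (hl h)) = card (edges I)"
proof -
  have "length (hl h) = card (hnbrs I h)" if "h < m" for h
    using hl[OF that] distinct_card by (metis is_pref_list_def)
  moreover have "finite (hnbrs I h)" for h
    using finite_subset[of "hnbrs I h" "{..<n}"] edges_bounds by (auto simp: hnbrs_def)
  moreover have "edges I = prod.swap ` Sigma {..<m} (hnbrs I)"
    using edges_bounds by (force simp: hnbrs_def)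
  ultimately show ?thesis by (simp add: card_SigmaI card_image)
qed

lemma instance_size_eq: "instance_size I = n + m + card (edges I)"
  by (simp add: instance_size_def residents hospitals)

lemma length_xs_le: "length xs \<le> 3 * instance_size I + 2"
proof -
  have "(\<Sum>j<k. Suc (length (l j))) = k + (\<Sum>j<k. length (l j))" for k and l :: "nat \<Rightarrow> nat list"
    by (induction k) auto
  then have "Suc (length xs) = 3 * m + 3 + n + 2 * card (edges I)"
    using length_xs sum_resident_lists sum_hospital_lists by (simp add: hs_def rs_def)
  then show ?thesis by (simp add: instance_size_eq)
qed

lemma lquota_le_uquota: "h < m \<Longrightarrow> lquota I h \<le> uquota I h"
  using inst hospitals by (auto simp: hrlq_instance_def)

lemma sum_lquota_le: "(\<Sum>h<m. lquota I h) \<le> n"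
proof -
  obtain M where M: "is_matching I M" "is_feasible I M" using feasible by blast
  have sub: "M \<subseteq> edges I" using M(1) by (simp add: is_matching_def)
  have fin: "finite {r. (r, h) \<in> M}" for h
    using sub edges_bounds by (auto intro: finite_subset[of _ "{..<n}"])
  have "(\<Sum>h<m. lquota I h) \<le> (\<Sum>h<m. card {r. (r, h) \<in> M})"
    using M(2) hospitals by (intro sum_mono) (auto simp: is_feasible_def)
  also have "\<dots> = card (\<Union>h<m. {r. (r, h) \<in> M})"
    using M(1) fin by (intro card_UN_disjoint[symmetric]) (auto simp: is_matching_def)
  also have "\<dots> \<le> card {..<n}"
    using sub edges_bounds by (intro card_mono) auto
  finally show ?thesis by simp
qed

end

section \<open>Deferred acceptance with bounded surplus\<close>

lemma sum_update:
  fixes g :: "nat \<Rightarrow> nat" and N :: nat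
  assumes "a < N"
  shows "(\<Sum>j<N. (if j = a then c else g j)) + g a = (\<Sum>j<N. g j) + c"
proof -
  have "(\<Sum>j<N. g j) = g a + (\<Sum>j\<in>{..<N} - {a}. g j)"
    using assms by (intro sum.remove) auto
  moreover have "(\<Sum>j<N. (if j = a then c else g j)) = c + (\<Sum>j\<in>{..<N} - {a}. g j)"
    using assms by (subst sum.remove[of _ a]) (auto intro!: sum.cong)
  ultimately show ?thesis by simp
qed

context encoded
begin

definition surplus_bound :: nat where
  "surplus_bound = n - (\<Sum>h<m. lquota I h)"

definition placed :: "(nat \<Rightarrow> nat) \<Rightarrow> (nat \<Rightarrow> nat) \<Rightarrow> (nat \<Rightarrow> nat) \<Rightarrow> nat \<Rightarrow> bool" where
  "placed p k M r \<longleftrightarrow>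
     (p r < re r \<and> M r = Suc (inp (p r)) \<and> rank r (inp (p r)) < k (inp (p r))) \<or>
     (p r = re r \<and> M r = 0)"

text \<open>Resident \<open>x\<close> is about to apply to the hospital at address \<open>p x\<close>, residents greater than \<open>i\<close> have
  not been considered yet, and hospital \<open>h\<close> admits the residents listed before address \<open>k h\<close>.
  The counter \<open>d h\<close> never decreases, and neither does the surplus \<open>b\<close>.\<close>

definition da_inv :: "nat \<Rightarrow> nat \<Rightarrow> nat \<Rightarrow> (nat \<Rightarrow> nat) \<Rightarrow> (nat \<Rightarrow> nat) \<Rightarrow> (nat \<Rightarrow> nat) \<Rightarrow> (nat \<Rightarrow> nat) \<Rightarrow> bool"
  where
  "da_inv i x b p k d M \<longleftrightarrow>
     i \<le> n \<and> x \<le> i \<and> (i = n \<longrightarrow> x = n) \<and>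
     (\<forall>r<n. rs r \<le> p r \<and> p r \<le> re r) \<and>
     (\<forall>r<n. \<forall>f. rs r \<le> f \<and> f < p r \<longrightarrow> k (inp f) \<le> rank r (inp f)) \<and>
     (\<forall>r<n. r = x \<or> i < r \<longrightarrow> M r = 0) \<and>
     (\<forall>r<n. r \<noteq> x \<and> r \<le> i \<longrightarrow> placed p k M r) \<and>
     (\<forall>h<m. hs h \<le> k h \<and> k h \<le> he h) \<and>
     (\<forall>h<m. d h = card {r. r < n \<and> M r = Suc h}) \<and>
     (\<forall>h<m. d h \<le> uquota I h \<and> (k h < he h \<longrightarrow> lquota I h \<le> d h)) \<and>
     b = (\<Sum>h<m. d h - lquota I h) \<and> b \<le> surplus_bound \<and>
     (b < surplus_bound \<longrightarrow> (\<forall>h<m. k h < he h \<longrightarrow> d h = uquota I h))"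

definition potential :: "nat \<Rightarrow> (nat \<Rightarrow> nat) \<Rightarrow> (nat \<Rightarrow> nat) \<Rightarrow> nat" where
  "potential i p k = (n - i) + (\<Sum>r<n. re r - p r) + (\<Sum>h<m. k h - hs h)"

lemma da_invD:
  assumes "da_inv i x b p k d M"
  shows "i \<le> n" and "x \<le> i" and "i = n \<Longrightarrow> x = n"
    and "r < n \<Longrightarrow> rs r \<le> p r" and "r < n \<Longrightarrow> p r \<le> re r"
    and "r < n \<Longrightarrow> rs r \<le> f \<Longrightarrow> f < p r \<Longrightarrow> k (inp f) \<le> rank r (inp f)"
    and "r < n \<Longrightarrow> r = x \<or> i < r \<Longrightarrow> M r = 0"
    and "r < n \<Longrightarrow> r \<noteq> x \<Longrightarrow> r \<le> i \<Longrightarrow> placed p k M r"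
    and "h < m \<Longrightarrow> hs h \<le> k h" and "h < m \<Longrightarrow> k h \<le> he h"
    and "h < m \<Longrightarrow> d h = card {r. r < n \<and> M r = Suc h}"
    and "h < m \<Longrightarrow> d h \<le> uquota I h"
    and "h < m \<Longrightarrow> k h < he h \<Longrightarrow> lquota I h \<le> d h"
    and "b = (\<Sum>h<m. d h - lquota I h)" and "b \<le> surplus_bound"
    and "b < surplus_bound \<Longrightarrow> h < m \<Longrightarrow> k h < he h \<Longrightarrow> d h = uquota I h"
  using assms by (auto simp only: da_inv_def)

lemma da_inv_start:
  assumes "\<forall>r<n. p r = rs r" "\<forall>h<m. k h = he h"
  shows "da_inv 0 0 0 p k (\<lambda>_. 0) (\<lambda>_. 0)"
  using assms rs_le_re hs_le_he unfolding da_inv_def by auto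

lemma potential_start:
  assumes "\<forall>r<n. p r = rs r" "\<forall>h<m. k h = he h"
  shows "potential 0 p k = n + 2 * card (edges I)"
proof -
  have "(\<Sum>r<n. re r - p r) = card (edges I)"
    using assms(1) by (simp add: sum_resident_lists[symmetric] re_def)
  moreover have "(\<Sum>h<m. k h - hs h) = card (edges I)"
    using assms(2) by (simp add: sum_hospital_lists[symmetric] he_def)
  ultimately show ?thesis by (simp add: potential_def)
qed

lemma da_inv_exhausted:
  assumes g: "da_inv i x b p k d M" "i < n" and x: "\<not> p x < re x"
  shows "da_inv (Suc i) (Suc i) b p k d M" "potential (Suc i) p k < potential i p k"
proof -
  note G = da_invD[OF g(1)]
  have xn: "x < n" "x \<le> i" using g(2) G(2) by auto
  have "p x = re x" "M x = 0" using G(5,7) xn x by (auto intro: antisym)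
  then have "placed p k M x" by (simp add: placed_def)
  then have "\<forall>r<n. r \<noteq> Suc i \<and> r \<le> Suc i \<longrightarrow> placed p k M r"
    using G(8) by (metis le_SucE)
  moreover have "\<forall>r<n. r = Suc i \<or> Suc i < r \<longrightarrow> M r = 0" using G(7) by auto
  moreover have "Suc i \<le> n" using g(2) by simp
  ultimately show "da_inv (Suc i) (Suc i) b p k d M"
    using g(1) unfolding da_inv_def by blast
  show "potential (Suc i) p k < potential i p k" using g(2) by (simp add: potential_def)
qed

lemma da_inv_advance:
  assumes g: "da_inv i x b p k d M" "i < n" and x: "p x < re x" "k (inp (p x)) \<le> rank x (inp (p x))"
  shows "da_inv i x b (p(x := Suc (p x))) k d M"
    and "potential i (p(x := Suc (p x))) k < potential i p k"
proof -
  have xn: "x < n" using g by (auto simp: da_inv_def)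
  have "placed (p(x := Suc (p x))) k M r \<longleftrightarrow> placed p k M r" if "r \<noteq> x" for r
    using that by (simp add: placed_def)
  then show "da_inv i x b (p(x := Suc (p x))) k d M"
    using g(1) x unfolding da_inv_def by (auto simp: less_Suc_eq)
  have "(\<Sum>r<n. re r - (p(x := Suc (p x))) r) < (\<Sum>r<n. re r - p r)"
    using xn x(1) by (intro sum_strict_mono_ex1) auto
  then show "potential i (p(x := Suc (p x))) k < potential i p k" by (simp add: potential_def)
qed

lemma da_inv_accept:
  assumes g: "da_inv i x b p k d M" "i < n" and x: "p x < re x"
    and h: "h = inp (p x)" "rank x h < k h"
    and acc: "d h < lquota I h \<and> b' = b \<or>
      lquota I h \<le> d h \<and> d h < uquota I h \<and> b < surplus_bound \<and> b' = Suc b"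
  shows "da_inv (Suc i) (Suc i) b' p k (d(h := Suc (d h))) (M(x := Suc h))"
    and "potential (Suc i) p k < potential i p k"
proof -
  note G = da_invD[OF g(1)]
  have xn: "x < n" "x \<le> i" using g(2) G(2) by auto
  then have xn: "x < n" "x \<le> i" "M x = 0" "rs x \<le> p x" using G(4,7) by auto
  have edge: "(x, h) \<in> edges I" using resident_entry_edge xn x h(1) by blast
  have hm: "h < m" using edges_bounds[OF edge] by simp
  have uq: "d h < uquota I h" using acc lquota_le_uquota[OF hm] by auto
  have card: "(d(h := Suc (d h))) h' = card {r. r < n \<and> (M(x := Suc h)) r = Suc h'}"
    if "h' < m" for h'
  proof (cases "h' = h")
    case True
    have "{r. r < n \<and> (M(x := Suc h)) r = Suc h'} = insert x {r. r < n \<and> M r = Suc h}"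
      using True xn by auto
    moreover have "x \<notin> {r. r < n \<and> M r = Suc h}" using xn by simp
    ultimately show ?thesis using g(1) hm True by (simp add: da_inv_def)
  next
    case False
    then have "{r. r < n \<and> (M(x := Suc h)) r = Suc h'} = {r. r < n \<and> M r = Suc h'}"
      using xn by auto
    then show ?thesis using g(1) that False by (simp add: da_inv_def)
  qed
  have pl: "\<forall>r<n. r \<noteq> Suc i \<and> r \<le> Suc i \<longrightarrow> placed p k (M(x := Suc h)) r"
  proof (intro allI impI)
    fix r assume r: "r < n" "r \<noteq> Suc i \<and> r \<le> Suc i"
    show "placed p k (M(x := Suc h)) r"
    proof (cases "r = x")
      case True
      then show ?thesis using x h by (simp add: placed_def)
    next
      case False
      then have "placed p k M r" using G(8) r by simp
      then show ?thesis using False by (simp add: placed_def)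
    qed
  qed
  have un: "\<forall>r<n. r = Suc i \<or> Suc i < r \<longrightarrow> (M(x := Suc h)) r = 0"
    using G(7) xn by auto
  have b: "b = (\<Sum>h<m. d h - lquota I h)" "b \<le> surplus_bound" using G(14,15) .
  have eq: "(\<Sum>j<m. (d(h := Suc (d h))) j - lquota I j) + (d h - lquota I h) = b + (Suc (d h) - lquota I h)"
  proof -
    have "(\<Sum>j<m. (d(h := Suc (d h))) j - lquota I j) =
        (\<Sum>j<m. (if j = h then Suc (d h) - lquota I h else d j - lquota I j))"
      by (intro sum.cong) auto
    then show ?thesis
      unfolding b(1) using sum_update[OF hm, of "Suc (d h) - lquota I h" "\<lambda>j. d j - lquota I j"]
      by simp
  qed
  have b': "b' = (\<Sum>j<m. (d(h := Suc (d h))) j - lquota I j)" "b' \<le> surplus_bound" "b \<le> b'"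
    using eq acc b(2) by auto
  have fullh: "d h' = uquota I h'" if "b' < surplus_bound" "h' < m" "k h' < he h'" for h'
    using G(16) that b'(3) by auto
  show "da_inv (Suc i) (Suc i) b' p k (d(h := Suc (d h))) (M(x := Suc h))"
    unfolding da_inv_def
  proof (intro conjI)
    show "\<forall>h'<m. (d(h := Suc (d h))) h' = card {r. r < n \<and> (M(x := Suc h)) r = Suc h'}"
      using card by blast
    show "\<forall>h'<m. (d(h := Suc (d h))) h' \<le> uquota I h' \<and>
        (k h' < he h' \<longrightarrow> lquota I h' \<le> (d(h := Suc (d h))) h')"
      using G(12,13) uq by (auto simp: le_Suc_eq)
    show "b' < surplus_bound \<longrightarrow> (\<forall>h'<m. k h' < he h' \<longrightarrow> (d(h := Suc (d h))) h' = uquota I h')"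
      using fullh uq by (metis fun_upd_other nat_less_le)
  qed (use G(4,5,6,9,10) g(2) pl un b' in auto)
  show "potential (Suc i) p k < potential i p k" using g(2) by (simp add: potential_def)
qed

lemma da_inv_evict:
  assumes g: "da_inv i x b p k d M" "i < n" and x: "p x < re x"
    and h: "h = inp (p x)" "rank x h < k h"
    and full: "lquota I h \<le> d h" "uquota I h \<le> d h \<or> surplus_bound \<le> b"
    and y: "y = inp (k h - 1)"
  shows "M y = Suc h \<Longrightarrow> da_inv i y b p (k(h := k h - 1)) d (M(y := 0, x := Suc h))"
    and "M y \<noteq> Suc h \<Longrightarrow> da_inv i x b p (k(h := k h - 1)) d M"
    and "potential i p (k(h := k h - 1)) < potential i p k"
    and "k h \<noteq> 0"
proof -
  let ?k = "k(h := k h - 1)"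
  note G = da_invD[OF g(1)]
  have xn: "x < n" "x \<le> i" using g(2) G(2) by auto
  then have xn: "x < n" "x \<le> i" "M x = 0" "rs x \<le> p x" using G(4,7) by auto
  have edge: "(x, h) \<in> edges I" using resident_entry_edge xn x h(1) by blast
  have hm: "h < m" using edges_bounds[OF edge] by simp
  have rk: "is_rank x h (rank x h)" using is_rank_rank[OF edge] .
  have kh: "hs h < k h" "k h \<le> he h" using rk h(2) g(1) hm by (auto simp: is_rank_def da_inv_def)
  have yrk: "is_rank y h (k h - 1)" using kh hm y by (auto simp: is_rank_def)
  have yrank: "rank y h = k h - 1" using rank_eq[OF yrk] .
  have yn: "y < n" using edges_bounds is_rank_edge[OF yrk] by blast
  have kle: "?k h' \<le> k h'" for h' by simp
  show "k h \<noteq> 0" using kh by simp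
  have "(\<Sum>j<m. ?k j - hs j) < (\<Sum>j<m. k j - hs j)"
    using hm kh by (intro sum_strict_mono_ex1) (auto intro!: bexI[of _ h])
  then show "potential i p ?k < potential i p k" by (simp add: potential_def)
  have below: "rank r h < ?k h" if "(r, h) \<in> edges I" "rank r h < k h" "r \<noteq> y" for r
  proof -
    have "rank r h \<noteq> k h - 1"
      using is_rank_rank[OF that(1)] yrk that(3) by (auto simp: is_rank_def)
    then show ?thesis using that(2) by simp
  qed
  have keep: "placed p ?k M r" if "placed p k M r" "r < n" "r \<noteq> y \<or> M y \<noteq> Suc h" for r
  proof (cases "p r < re r")
    case True
    have pr: "rs r \<le> p r" using g(1) that(2) by (auto simp: da_inv_def)
    have "(r, inp (p r)) \<in> edges I" using resident_entry_edge[OF that(2) pr True] .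
    then show ?thesis using below[of r] that True by (auto simp: placed_def)
  next
    case False
    then show ?thesis using that by (auto simp: placed_def)
  qed
  have rej: "\<forall>r<n. \<forall>f. rs r \<le> f \<and> f < p r \<longrightarrow> ?k (inp f) \<le> rank r (inp f)"
    using G(6) kle le_trans by blast
  have bds: "\<forall>h<m. hs h \<le> ?k h \<and> ?k h \<le> he h"
    using G(9,10) kh by (auto intro: le_trans[OF diff_le_self])
  have low: "\<forall>h<m. d h \<le> uquota I h \<and> (?k h < he h \<longrightarrow> lquota I h \<le> d h)"
    using G(12,13) full(1) by auto
  have ful: "b < surplus_bound \<longrightarrow> (\<forall>h<m. ?k h < he h \<longrightarrow> d h = uquota I h)"
  proof (intro impI allI)
    fix h' assume *: "b < surplus_bound" "h' < m" "?k h' < he h'"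
    show "d h' = uquota I h'"
    proof (cases "h' = h")
      case True
      then show ?thesis using full(2) *(1) G(12)[OF hm] by auto
    next
      case False
      then show ?thesis using G(16) * by simp
    qed
  qed
  have ptr: "\<forall>r<n. rs r \<le> p r \<and> p r \<le> re r" using G(4,5) by blast
  have ne: "i = n \<longrightarrow> z = n" for z using g(2) by simp
  note rest = G(1) ptr rej bds low G(14,15) ful
  show "da_inv i x b p ?k d M" if "M y \<noteq> Suc h"
  proof -
    have "\<forall>r<n. r \<noteq> x \<and> r \<le> i \<longrightarrow> placed p ?k M r" using G(8) keep that by blast
    moreover have "\<forall>r<n. r = x \<or> i < r \<longrightarrow> M r = 0" using G(7) by blast
    moreover have "\<forall>h<m. d h = card {r. r < n \<and> M r = Suc h}" using G(11) by blast
    ultimately show ?thesis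
      unfolding da_inv_def using rest G(2) ne[of x] by (intro conjI) assumption+
  qed
  show "da_inv i y b p ?k d (M(y := 0, x := Suc h))" if My: "M y = Suc h"
  proof -
    let ?M = "M(y := 0, x := Suc h)"
    have yx: "y \<noteq> x" using My xn by auto
    have yi: "y \<le> i" using G(7)[OF yn] My by fastforce
    have "\<forall>r<n. r \<noteq> y \<and> r \<le> i \<longrightarrow> placed p ?k ?M r"
    proof (intro allI impI)
      fix r assume r: "r < n" "r \<noteq> y \<and> r \<le> i"
      show "placed p ?k ?M r"
      proof (cases "r = x")
        case True
        then show ?thesis using below[OF edge h(2)] x h yx by (simp add: placed_def)
      next
        case False
        then have "placed p ?k M r" using G(8) keep r by blast
        then show ?thesis using False r by (simp add: placed_def)
      qed
    qed
    moreover have "\<forall>r<n. r = y \<or> i < r \<longrightarrow> ?M r = 0" using G(7) yx xn by auto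
    moreover have "\<forall>h'<m. d h' = card {r. r < n \<and> ?M r = Suc h'}"
    proof (intro allI impI)
      fix h' assume h': "h' < m"
      have d: "d h' = card {r. r < n \<and> M r = Suc h'}" using G(11)[OF h'] .
      show "d h' = card {r. r < n \<and> ?M r = Suc h'}"
      proof (cases "h' = h")
        case True
        have "{r. r < n \<and> ?M r = Suc h'} = insert x ({r. r < n \<and> M r = Suc h} - {y})"
          using True xn yx by auto
        moreover have "card (insert x ({r. r < n \<and> M r = Suc h} - {y})) = card {r. r < n \<and> M r = Suc h}"
          using xn yn My card_Suc_Diff1[of "{r. r < n \<and> M r = Suc h}" y]
          by (subst card_insert_disjoint) auto
        ultimately show ?thesis using d True by simp
      next
        case False
        then have "{r. r < n \<and> ?M r = Suc h'} = {r. r < n \<and> M r = Suc h'}" using xn My by auto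
        then show ?thesis using d by simp
      qed
    qed
    ultimately show ?thesis
      unfolding da_inv_def using rest yi ne[of y] by (intro conjI) assumption+
  qed
qed

lemma da_inv_final:
  assumes g: "da_inv n x b p k d M"
  defines "N \<equiv> {(r, h). r < n \<and> M r = Suc h}"
  shows "feasible_ef_matching I N"
    and "feasible_ef_matching I N' \<Longrightarrow> fst ` N' \<subseteq> fst ` N"
proof -
  note G = da_invD[OF g]
  note pb = G(4,5) and rej = G(6)
  have pl: "placed p k M r" if "r < n" for r using G(8)[of r] G(3) that by simp
  have d: "d h = card {r. (r, h) \<in> N}" if "h < m" for h
    using G(11)[OF that] by (simp add: N_def)
  have N: "p r < re r \<and> h = inp (p r) \<and> r < n \<and> (r, h) \<in> edges I \<and> rank r h < k h" if "(r, h) \<in> N" for r h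
    using that pl[of r] pb[of r] resident_entry_edge[of r "p r"] by (auto simp: N_def placed_def)
  have admitted: "\<exists>h'. (r, h') \<in> N \<and> (h' = h \<or> rprefers I r h' h)"
    if e: "(r, h) \<in> edges I" "rank r h < k h" for r h
  proof -
    have r: "r < n" using edges_bounds[OF e(1)] by simp
    obtain f where f: "rs r \<le> f" "f < re r" "inp f = h" using edge_resident_entry[OF e(1)] .
    have pf: "p r \<le> f" using rej[OF r f(1)] f(3) e(2) by (meson leD leI)
    then have "(r, inp (p r)) \<in> N" using pl[OF r] r f by (auto simp: N_def placed_def)
    moreover have "inp (p r) = h \<or> rprefers I r (inp (p r)) h"
      using resident_entries_sorted[OF r pb(1)[OF r], of f] f pf by (cases "p r = f") auto
    ultimately show ?thesis by blast
  qed
  have match: "is_matching I N"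
    unfolding is_matching_def
  proof (intro conjI ballI)
    show "N \<subseteq> edges I" using N by auto
    show "\<forall>r h h'. (r, h) \<in> N \<and> (r, h') \<in> N \<longrightarrow> h = h'" by (simp add: N_def)
    show "card {r. (r, h) \<in> N} \<le> uquota I h" if "h \<in> hospitals I" for h
      using G(12)[of h] d[of h] that by (simp add: hospitals)
  qed
  have fst_N: "fst ` N \<subseteq> {..<n}" using N by auto
  have card_N: "card (fst ` N) = (\<Sum>h<m. d h)"
  proof -
    have "fst ` N = (\<Union>h<m. {r. (r, h) \<in> N})"
      using N edges_bounds by force
    also have "card \<dots> = (\<Sum>h<m. card {r. (r, h) \<in> N})"
      using N by (intro card_UN_disjoint) (auto simp: N_def)
    also have "\<dots> = (\<Sum>h<m. d h)" using d by simp
    finally show ?thesis .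
  qed
  have b: "b = (\<Sum>h<m. d h - lquota I h)" "b \<le> surplus_bound"
    using G(14,15) .
  have feas: "lquota I h \<le> d h" if h: "h < m" for h
  proof (rule ccontr)
    assume less: "\<not> lquota I h \<le> d h"
    then have kh: "k h = he h" using G(10,13)[OF h] by fastforce
    have "r \<in> fst ` N" if "r < n" for r
    proof -
      have e: "(r, h) \<in> edges I"
        using CL that h less by (auto simp: CL_restricted_def residents hospitals)
      show ?thesis using admitted[OF e] is_rank_rank[OF e] kh by (force simp: is_rank_def)
    qed
    then have "fst ` N = {..<n}" using fst_N by blast
    then have "(\<Sum>h<m. d h) = n" using card_N by simp
    moreover have "(\<Sum>h<m. d h) < (\<Sum>h<m. lquota I h + (d h - lquota I h))"
      using h less by (intro sum_strict_mono_ex1) (auto intro!: bexI[of _ h])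
    ultimately show False using b sum_lquota_le by (simp add: sum.distrib surplus_bound_def)
  qed
  have "\<not> envies I N r r'" for r r'
  proof
    assume "envies I N r r'"
    then obtain h where h: "(r', h) \<in> N" "(r, h) \<in> edges I" "prefers_to_partner I N r h"
      "hprefers I h r r'"
      using partner_eq_Some[OF match] by (auto simp: envies_def)
    have "rank r h < k h" using rank_mono[OF h(2) _ h(4)] N[OF h(1)] by fastforce
    then obtain h' where h': "(r, h') \<in> N" "h' = h \<or> rprefers I r h' h"
      using admitted[OF h(2)] by blast
    then have "rprefers I r h h'"
      using h(3) partner_eq_Some[OF match, of r h'] by (simp add: prefers_to_partner_def)
    then show False using rprefers_asym[of r h h'] h(2) h' N[OF h'(1)] by blast
  qed
  then show "feasible_ef_matching I N"
    using match feas d by (auto simp: feasible_ef_matching_def is_feasible_def envy_free_def hospitals)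
  show "fst ` N' \<subseteq> fst ` N" if N': "feasible_ef_matching I N'"
  proof (cases "b < surplus_bound")
    case True
    show ?thesis
    proof (rule matched_subset_stable[OF inst match])
      fix r h assume e: "(r, h) \<in> edges I" and pref: "prefers_to_partner I N r h"
      have h: "h < m" using edges_bounds[OF e] by simp
      have notadm: "k h \<le> rank r h"
      proof (rule ccontr)
        assume "\<not> k h \<le> rank r h"
        then obtain h' where h': "(r, h') \<in> N" "h' = h \<or> rprefers I r h' h"
          using admitted[OF e] by auto
        then have "rprefers I r h h'"
          using pref partner_eq_Some[OF match, of r h'] by (simp add: prefers_to_partner_def)
        then show False using rprefers_asym[of r h h'] e h' N[OF h'(1)] by blast
      qed
      then have "k h < he h" using is_rank_rank[OF e] by (simp add: is_rank_def)
      then have "d h = uquota I h" using G(16) True h by blast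
      moreover have "hprefers I h z r" if "(z, h) \<in> N" for z
        using is_rank_less[OF is_rank_rank is_rank_rank, of z h r] N[OF that] notadm e by auto
      ultimately show "card {z. (z, h) \<in> N} = uquota I h \<and> (\<forall>z. (z, h) \<in> N \<longrightarrow> hprefers I h z r)"
        using d[OF h] by simp
    qed (use N' in \<open>auto simp: feasible_ef_matching_def\<close>)
  next
    case False
    have "(\<Sum>h<m. d h) = (\<Sum>h<m. lquota I h + (d h - lquota I h))"
      using feas by (intro sum.cong) auto
    then have "card (fst ` N) = n"
      using False b card_N sum_lquota_le by (simp add: sum.distrib surplus_bound_def)
    then have "fst ` N = {..<n}" using fst_N by (intro card_subset_eq) auto
    moreover have "fst ` N' \<subseteq> {..<n}"
      using N' edges_bounds by (auto simp: feasible_ef_matching_def is_matching_def)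
    ultimately show ?thesis by simp
  qed
qed

end

section \<open>The program\<close>

primrec block :: "com list \<Rightarrow> com" where
  "block [] = Skip"
| "block (c # cs) = Seq c (block cs)"

lemma wp_block [simp]:
  "wp W (block []) Q k R A \<longleftrightarrow> 1 \<le> k \<and> Q (k - 1) R A"
  "wp W (block (c # cs)) Q k R A \<longleftrightarrow> wp W c (wp W (block cs) Q) k R A"
  by simp_all

declare block.simps [simp del]

text \<open>Keeps the simplifier out of programs and postconditions, so that symbolic execution stops at named
  subprograms and leaves invariants intact.\<close>

lemma wp_cong [cong]:
  "k = k' \<Longrightarrow> R = R' \<Longrightarrow> A = A' \<Longrightarrow> wp W p Q k R A \<longleftrightarrow> wp W p Q k' R' A'"
  by simp

abbreviation (input) "rZero \<equiv> 0 :: nat"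
abbreviation (input) "rOne \<equiv> 2 :: nat"
abbreviation (input) "rN \<equiv> 3 :: nat"
abbreviation (input) "rM \<equiv> 4 :: nat"
abbreviation (input) "rLow \<equiv> 5 :: nat"
abbreviation (input) "rUp \<equiv> 6 :: nat"
abbreviation (input) "rCur \<equiv> 7 :: nat"
abbreviation (input) "rBound \<equiv> 8 :: nat"
abbreviation (input) "rI \<equiv> 9 :: nat"
abbreviation (input) "rT \<equiv> 10 :: nat"
abbreviation (input) "rU \<equiv> 11 :: nat"
abbreviation (input) "rH \<equiv> 12 :: nat"
abbreviation (input) "rR \<equiv> 13 :: nat"
abbreviation (input) "rE \<equiv> 14 :: nat"
abbreviation (input) "rF \<equiv> 15 :: nat"
abbreviation (input) "rX \<equiv> 16 :: nat"
abbreviation (input) "rSur \<equiv> 17 :: nat"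
abbreviation (input) "rCut \<equiv> 18 :: nat"
abbreviation (input) "rD \<equiv> 19 :: nat"
abbreviation (input) "rLq \<equiv> 20 :: nat"
abbreviation (input) "rUq \<equiv> 21 :: nat"
abbreviation (input) "rG \<equiv> 22 :: nat"
abbreviation (input) "rY \<equiv> 23 :: nat"

abbreviation (input) "aIn \<equiv> 0 :: nat"
abbreviation (input) "aMatch \<equiv> 1 :: nat"
abbreviation (input) "aPtr \<equiv> 2 :: nat"
abbreviation (input) "aEnd \<equiv> 3 :: nat"
abbreviation (input) "aCut \<equiv> 4 :: nat"
abbreviation (input) "aCount \<equiv> 5 :: nat"
abbreviation (input) "aHead \<equiv> 6 :: nat"
abbreviation (input) "aNext \<equiv> 7 :: nat"
abbreviation (input) "aOwner \<equiv> 8 :: nat"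
abbreviation (input) "aTmp \<equiv> 9 :: nat"
abbreviation (input) "aRank \<equiv> 10 :: nat"

definition init_prog :: com where
  "init_prog = block
    [Const rOne 1, Load rN aIn rZero, Load rM aIn rOne, Add rLow rOne rOne, Add rUp rLow rM,
     Add rCur rUp rM, Copy rBound rN]"

definition residents_prog :: com where
  "residents_prog = While (Less rI rN) (block
    [Load rT aIn rCur, Add rCur rCur rOne, Store aPtr rI rCur, Add rCur rCur rT,
     Store aEnd rI rCur, Add rI rI rOne])"

text \<open>The entries of the hospital lists that name resident \<open>r\<close> are chained into a linked list with
  head \<open>aHead[r]\<close>; address 0 ends the list.\<close>

definition link_prog :: com where
  "link_prog = While (Less rCur rU) (block
    [Load rR aIn rCur, Load rT aHead rR, Store aNext rCur rT, Store aHead rR rCur,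
     Store aOwner rCur rH, Add rCur rCur rOne])"

definition hospitals_prog :: com where
  "hospitals_prog = While (Less rH rM) (block
    [Add rT rLow rH, Load rT aIn rT, Sub rBound rBound rT,
     Load rT aIn rCur, Add rCur rCur rOne, Add rU rCur rT, Store aCut rH rU,
     link_prog, Add rH rH rOne])"

definition scatter_prog :: com where
  "scatter_prog = While (Less rZero rE) (block
    [Load rT aOwner rE, Store aTmp rT rE, Load rE aNext rE])"

definition gather_prog :: com where
  "gather_prog = While (Less rF rU) (block
    [Load rH aIn rF, Load rT aTmp rH, Store aRank rF rT, Add rF rF rOne])"

definition ranks_prog :: com where
  "ranks_prog = While (Less rR rN) (block
    [Load rE aHead rR, scatter_prog, Load rF aPtr rR, Load rU aEnd rR, gather_prog,
     Add rR rR rOne])"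

definition next_prog :: com where
  "next_prog = block [Add rI rI rOne, Copy rX rI]"

definition accept_prog :: com where
  "accept_prog = block [Add rD rD rOne, Store aCount rH rD, Store aMatch rX rG, next_prog]"

definition evict_prog :: com where
  "evict_prog = block
    [Sub rCut rCut rOne, Store aCut rH rCut, Load rY aIn rCut, Load rT aMatch rY,
     Branch (Equal rT rG) (block [Store aMatch rY rZero, Store aMatch rX rG, Copy rX rY]) Skip]"

definition decide_prog :: com where
  "decide_prog = Branch (Less rD rLq) accept_prog
     (Branch (Less rD rUq)
       (Branch (Less rSur rBound) (Seq (Add rSur rSur rOne) accept_prog) evict_prog)
       evict_prog)"

definition apply_prog :: com where
  "apply_prog = block
    [Load rD aCount rH, Add rLq rLow rH, Load rLq aIn rLq, Add rUq rUp rH, Load rUq aIn rUq,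
     Add rG rH rOne, decide_prog]"

definition main_prog :: com where
  "main_prog = While (Less rI rN) (block
    [Load rF aPtr rX, Load rU aEnd rX,
     Branch (Less rF rU)
       (block
         [Load rH aIn rF, Load rT aRank rF, Load rCut aCut rH,
          Branch (Less rT rCut) apply_prog (block [Add rF rF rOne, Store aPtr rX rF])])
       next_prog])"

definition cl_prog :: com where
  "cl_prog = block
    [init_prog, residents_prog, hospitals_prog, Const rR 0, ranks_prog, Const rI 0, main_prog]"

context encoded
begin

definition entry :: "nat \<Rightarrow> nat \<Rightarrow> bool" where
  "entry r e \<longleftrightarrow> (\<exists>h. is_rank r h e)"

text \<open>Address 0 holds no list entry and stands for "none".\<close>

primrec last_entry :: "nat \<Rightarrow> nat \<Rightarrow> nat" where
  "last_entry r 0 = 0"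
| "last_entry r (Suc c) = (if entry r c then c else last_entry r c)"

definition entries_below :: "nat \<Rightarrow> nat \<Rightarrow> nat" where
  "entries_below r c = card {e. e < c \<and> entry r e}"

lemma entry_bounds: "entry r e \<Longrightarrow> hs 0 \<le> e \<and> e < hs m"
proof -
  assume "entry r e"
  then obtain h where h: "h < m" "hs h \<le> e" "e < he h" by (auto simp: entry_def is_rank_def)
  then show ?thesis using hs_mono[of 0 h] he_less[of h m] by simp
qed

lemma not_entry_0: "\<not> entry r 0"
  using entry_bounds[of r 0] hs_gt[of 0] by auto

lemma entry_iff:
  assumes "h < m" "hs h \<le> e" "e < he h"
  shows "entry r e \<longleftrightarrow> r = inp e"
  using assms by (auto simp: entry_def is_rank_def)

lemma not_entry_he: "\<not> entry r (he h)"
proof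
  assume "entry r (he h)"
  then obtain h' where h': "h' < m" "hs h' \<le> he h" "he h < he h'"
    by (auto simp: entry_def is_rank_def)
  consider "h' < h" | "h' = h" | "h < h'" by linarith
  then show False using h' he_less[of h' h] he_less[of h h'] hs_le_he[of h] by cases auto
qed

lemma last_entry_start: "c \<le> hs 0 \<Longrightarrow> last_entry r c = 0"
proof (induction c)
  case (Suc c)
  then show ?case using entry_bounds[of r c] by auto
qed simp

lemma last_entry_cases: "last_entry r c = 0 \<or> entry r (last_entry r c)"
  by (induction c) auto

lemma last_entry_ge: "entry r e \<Longrightarrow> e < c \<Longrightarrow> e \<le> last_entry r c"
  by (induction c) (auto simp: less_Suc_eq)

lemma entries_below_Suc: "entries_below r (Suc c) = entries_below r c + (if entry r c then 1 else 0)"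
proof -
  have "{e. e < Suc c \<and> entry r e} = (if entry r c then insert c else id) {e. e < c \<and> entry r e}"
    by (auto simp: less_Suc_eq)
  then show ?thesis by (simp add: entries_below_def)
qed

lemma entries_below_last: "entries_below r (Suc (last_entry r c)) = entries_below r c"
proof (induction c)
  case 0
  have "entries_below r 0 = 0" by (simp add: entries_below_def)
  then show ?case using not_entry_0 by (simp add: entries_below_Suc)
qed (simp add: entries_below_Suc)

lemma entries_below_total:
  assumes "r < n"
  shows "entries_below r (hs m) = length (rl r)"
proof -
  have "{e. e < hs m \<and> entry r e} = rank r ` rnbrs I r"
  proof (intro equalityI subsetI)
    fix e assume "e \<in> {e. e < hs m \<and> entry r e}"
    then obtain h where "is_rank r h e" by (auto simp: entry_def)
    then show "e \<in> rank r ` rnbrs I r"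
      using rank_eq[of r h e] is_rank_edge[of r h e] by (auto simp: rnbrs_def)
  next
    fix e assume "e \<in> rank r ` rnbrs I r"
    then obtain h where "is_rank r h e" using is_rank_rank by (auto simp: rnbrs_def)
    then have "entry r e" by (auto simp: entry_def)
    then show "e \<in> {e. e < hs m \<and> entry r e}" using entry_bounds by simp
  qed
  moreover have "inj_on (rank r) (rnbrs I r)"
  proof (rule inj_onI)
    fix h h' assume "h \<in> rnbrs I r" "h' \<in> rnbrs I r" "rank r h = rank r h'"
    then show "h = h'"
      using is_rank_hospital_unique[of r h "rank r h" r h'] is_rank_rank[of r h] is_rank_rank[of r h']
      by (simp add: rnbrs_def)
  qed
  ultimately have "entries_below r (hs m) = card (rnbrs I r)"
    by (simp add: entries_below_def card_image)
  then show ?thesis using rl[OF assms] distinct_card by (metis is_pref_list_def)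
qed

end

locale encoded_word = encoded +
  fixes W :: nat
  assumes word: "length xs + 2 \<le> W"
begin

definition base :: "(nat \<Rightarrow> nat) \<Rightarrow> (nat \<Rightarrow> nat \<Rightarrow> nat) \<Rightarrow> bool" where
  "base R A \<longleftrightarrow> R rZero = 0 \<and> R rOne = 1 \<and> R rN = n \<and> R rM = m \<and> R rLow = 2 \<and> R rUp = 2 + m \<and>
     R rSur = 0 \<and> R rX = 0 \<and> A aIn = inp \<and> A aMatch = (\<lambda>_. 0) \<and> A aCount = (\<lambda>_. 0)"

definition parsed_residents :: "nat \<Rightarrow> (nat \<Rightarrow> nat \<Rightarrow> nat) \<Rightarrow> bool" where
  "parsed_residents i A \<longleftrightarrow> (\<forall>r<i. A aPtr r = rs r \<and> A aEnd r = re r)"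

lemma length_xs_ge: "n + 3 * m + 2 \<le> length xs"
proof -
  have "k \<le> (\<Sum>j<k. Suc (length (l j)))" for k and l :: "nat \<Rightarrow> nat list"
    by (induction k) auto
  from this[of n rl] this[of m hl] show ?thesis using length_xs by (simp add: hs_def rs_def)
qed

lemma wp_init:
  assumes "R = (\<lambda>_. 0)" "A = (\<lambda>a. if a = 0 then inp else (\<lambda>_. 0))"
  shows "wp W init_prog (\<lambda>_ R A. base R A \<and> R rCur = 2 * m + 2 \<and> R rBound = n \<and>
    R rI = 0 \<and> R rH = 0 \<and> A aHead = (\<lambda>_. 0)) 8 R A"
  unfolding init_prog_def using word length_xs_ge
  by (simp add: assms inp_0 inp_1 base_def)

lemma wp_residents:
  assumes "base R A" "R rCur = 2 * m + 2" "R rBound = n" "R rI = 0" "R rH = 0"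
    "A aHead = (\<lambda>_. 0)"
  shows "wp W residents_prog (\<lambda>_ R A. base R A \<and> Suc (R rCur) = rs n \<and> R rBound = n \<and>
    R rH = 0 \<and> A aHead = (\<lambda>_. 0) \<and> parsed_residents n A) (8 * n + 1) R A"
  unfolding residents_prog_def
proof (rule wp_While[where Inv = "\<lambda>k R A. base R A \<and> R rI \<le> n \<and> Suc (R rCur) = rs (R rI) \<and>
    R rBound = n \<and> R rH = 0 \<and> A aHead = (\<lambda>_. 0) \<and> parsed_residents (R rI) A \<and>
    8 * (n - R rI) + 1 \<le> k"], goal_cases)
  case 1
  then show ?case using assms by (simp add: rs_0 parsed_residents_def)
next
  case (3 k R A)
  then have i: "R rI < n" "A aIn = inp" "R rOne = 1" by (auto simp: base_def)
  have cur: "R rCur = rs (R rI) - 1" using 3 by linarith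
  have len: "inp (R rCur) = length (rl (R rI))" using inp_resident_length i(1) cur by simp
  have W: "re (R rI) \<le> W" using re_le_length[OF i(1)] word by simp
  show ?case
    using 3 i len W length_xs_ge word
    by (auto simp: base_def parsed_residents_def rs_Suc re_def less_Suc_eq)
qed (auto simp: base_def)

definition linked :: "nat \<Rightarrow> (nat \<Rightarrow> nat \<Rightarrow> nat) \<Rightarrow> bool" where
  "linked c A \<longleftrightarrow> (\<forall>r. A aHead r = last_entry r c) \<and>
     (\<forall>r h e. is_rank r h e \<and> e < c \<longrightarrow> A aNext e = last_entry r e \<and> A aOwner e = h)"

lemma linked_Suc:
  assumes "linked c A" "h < m" "hs h \<le> c" "c < he h"
  shows "linked (Suc c) (A(aNext := (A aNext)(c := A aHead (inp c)),
    aHead := (A aHead)(inp c := c), aOwner := (A aOwner)(c := h)))"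
proof -
  have "h' = h \<and> r = inp c" if "is_rank r h' c" for r h'
    using is_rank_hospital_unique[OF that, of "inp c" h] that assms(2-4) by (auto simp: is_rank_def)
  then show ?thesis
    using assms entry_iff[OF assms(2-4)] by (auto simp: linked_def less_Suc_eq)
qed

lemma wp_link:
  assumes "base R A" "parsed_residents n A" "linked (R rCur) A" "h < m" "R rH = h"
    "R rCur = hs h" "R rU = he h" "\<forall>h'\<le>h. A aCut h' = he h'" "R rBound = b"
  shows "wp W link_prog (\<lambda>_ R A. base R A \<and> parsed_residents n A \<and> linked (he h) A \<and> R rH = h \<and>
    R rCur = he h \<and> (\<forall>h'\<le>h. A aCut h' = he h') \<and> R rBound = b) (8 * length (hl h) + 1) R A"
  unfolding link_prog_def
proof (rule wp_While[where Inv = "\<lambda>k R A. base R A \<and> parsed_residents n A \<and> linked (R rCur) A \<and>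
    R rH = h \<and> hs h \<le> R rCur \<and> R rCur \<le> he h \<and> R rU = he h \<and> (\<forall>h'\<le>h. A aCut h' = he h') \<and>
    R rBound = b \<and> 8 * (he h - R rCur) + 1 \<le> k"], goal_cases)
  case 1
  then show ?case using assms by (simp add: he_def)
next
  case (3 k R A)
  then have c: "hs h \<le> R rCur" "R rCur < he h" by auto
  have W: "he h \<le> W" using he_le_length[OF assms(4)] word by simp
  show ?case
    using 3 linked_Suc[OF _ assms(4) c, of A] W
    by (auto simp: base_def parsed_residents_def)
qed auto

lemma linked_he: "linked (he h) A \<Longrightarrow> linked (Suc (he h)) A"
  using not_entry_he[of _ h] unfolding linked_def entry_def by (simp add: less_Suc_eq entry_def) blast

lemma wp_hospitals:
  assumes "base R A" "parsed_residents n A" "Suc (R rCur) = hs 0" "R rBound = n" "R rH = 0"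
    "A aHead = (\<lambda>_. 0)"
  shows "wp W hospitals_prog (\<lambda>_ R A. base R A \<and> parsed_residents n A \<and> linked (hs m) A \<and>
    (\<forall>h<m. A aCut h = he h) \<and> R rBound = surplus_bound) (12 * (hs m - hs 0) + 1) R A"
  unfolding hospitals_prog_def
proof (rule wp_While[where Inv = "\<lambda>k R A. base R A \<and> parsed_residents n A \<and> linked (hs (R rH)) A \<and>
    R rH \<le> m \<and> Suc (R rCur) = hs (R rH) \<and> (\<forall>h<R rH. A aCut h = he h) \<and>
    R rBound = n - (\<Sum>h<R rH. lquota I h) \<and> 12 * (hs m - hs (R rH)) + 1 \<le> k"], goal_cases)
  case 1
  have "linked (hs 0) A"
    using assms(6) last_entry_start[of "hs 0"] entry_bounds leD
    unfolding linked_def entry_def by (metis order_refl)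
  then show ?case using assms by simp
next
  case (3 k R A)
  define h where "h = R rH"
  have inv: "base R A" "parsed_residents n A" "linked (hs h) A" "Suc (R rCur) = hs h"
    "\<forall>h'<h. A aCut h' = he h'" "R rBound = n - (\<Sum>h'<h. lquota I h')"
    "12 * (hs m - hs h) + 1 \<le> k" "h < m"
    using 3 by (auto simp: h_def base_def)
  have hs: "hs h + length (hl h) + 1 \<le> hs m" using hs_mono[of "Suc h" m] inv(8) by (simp add: hs_Suc he_def)
  have len: "inp (R rCur) = length (hl h)"
    using inp_hospital_length[OF inv(8)] inv(4) by (metis diff_Suc_1)
  have W: "he h \<le> W" "2 + 2 * m \<le> W"
    using he_le_length[OF inv(8)] word length_xs_ge by simp_all
  have L: "wp W link_prog (wp W (block [Add rH rH rOne]) (\<lambda>k R A. base R A \<and>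
    parsed_residents n A \<and> linked (hs (R rH)) A \<and>
    R rH \<le> m \<and> Suc (R rCur) = hs (R rH) \<and> (\<forall>h<R rH. A aCut h = he h) \<and>
    R rBound = n - (\<Sum>h<R rH. lquota I h) \<and> 12 * (hs m - hs (R rH)) + 1 \<le> k)) k' R' A'"
    if "base R' A'" "parsed_residents n A'" "linked (R' rCur) A'" "R' rH = h"
      "R' rCur = hs h" "R' rU = he h" "\<forall>h'\<le>h. A' aCut h' = he h'"
      "R' rBound = n - (\<Sum>h'<Suc h. lquota I h')" "12 * (hs m - hs h) - 7 \<le> k'" for k' R' A'
  proof (rule wp_conseq[OF wp_link[OF that(1-3) inv(8) that(4-8)]])
    show "8 * length (hl h) + 1 \<le> k'" using that(9) hs by simp
    fix k'' R'' A''
    assume post: "base R'' A'' \<and> parsed_residents n A'' \<and> linked (he h) A'' \<and> R'' rH = h \<and>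
      R'' rCur = he h \<and> (\<forall>h'\<le>h. A'' aCut h' = he h') \<and> R'' rBound = n - (\<Sum>h'<Suc h. lquota I h')"
      and k'': "k' \<le> k'' + (8 * length (hl h) + 1)"
    have "12 * (hs m - hs (Suc h)) + 3 \<le> k''"
      using k'' that(9) hs by (simp add: hs_Suc he_def)
    then show "wp W (block [Add rH rH rOne]) (\<lambda>k R A. base R A \<and>
      parsed_residents n A \<and> linked (hs (R rH)) A \<and>
      R rH \<le> m \<and> Suc (R rCur) = hs (R rH) \<and> (\<forall>h<R rH. A aCut h = he h) \<and>
      R rBound = n - (\<Sum>h<R rH. lquota I h) \<and> 12 * (hs m - hs (R rH)) + 1 \<le> k) k'' R'' A''"
      using post inv(8) W linked_he by (auto simp: base_def hs_Suc less_Suc_eq_le)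
  qed
  have cut: "\<forall>h'\<le>h. ((A aCut)(h := he h)) h' = he h'" using inv(5) by auto
  have he: "hs h + length (hl h) = he h" by (simp add: he_def)
  show ?case
    using inv len W inp_lquota[OF inv(8)] h_def[symmetric] hs cut hs_le_he[of h]
    by (simp add: base_def parsed_residents_def linked_def he)
      (intro conjI L; (linarith | simp add: base_def parsed_residents_def linked_def; blast))
qed (auto simp: surplus_bound_def base_def)

definition ready :: "(nat \<Rightarrow> nat) \<Rightarrow> (nat \<Rightarrow> nat \<Rightarrow> nat) \<Rightarrow> bool" where
  "ready R A \<longleftrightarrow> base R A \<and> parsed_residents n A \<and> linked (hs m) A \<and>
    (\<forall>h<m. A aCut h = he h) \<and> R rBound = surplus_bound"

lemma ready_update [simp]:
  "v \<notin> {rZero, rOne, rN, rM, rLow, rUp, rBound, rX, rSur} \<Longrightarrow> ready (R(v := c)) A \<longleftrightarrow> ready R A"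
  by (simp add: ready_def base_def)

definition ranked :: "nat \<Rightarrow> (nat \<Rightarrow> nat) \<Rightarrow> bool" where
  "ranked c a \<longleftrightarrow> (\<forall>r f. r < n \<and> rs r \<le> f \<and> f < re r \<and> f < c \<longrightarrow> a f = rank r (inp f))"

lemma resident_block_unique:
  assumes "rs r \<le> f" "f \<le> re r" "rs r' \<le> f" "f \<le> re r'"
  shows "r = r'"
proof (rule ccontr)
  assume "r \<noteq> r'"
  then consider "r < r'" | "r' < r" by linarith
  then show False using re_less[of r r'] re_less[of r' r] assms by cases auto
qed

lemma ranked_Suc:
  assumes "ranked c a" "rs r \<le> c" "c < re r"
  shows "ranked (Suc c) (a(c := rank r (inp c)))"
proof -
  have "r' = r" if "rs r' \<le> c" "c < re r'" for r'
    using resident_block_unique[of r c r'] that assms(2,3) by simp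
  then show ?thesis using assms(1) by (simp add: ranked_def less_Suc_eq) blast
qed

lemma ranked_re: "ranked (re r) a \<Longrightarrow> ranked (Suc (re r)) a"
proof -
  assume *: "ranked (re r) a"
  have "f \<noteq> re r" if "rs r' \<le> f" "f < re r'" for r' f
    using resident_block_unique[of r "re r" r'] rs_le_re[of r] that by auto
  then show ?thesis using * by (auto simp: ranked_def less_Suc_eq)
qed

lemma wp_scatter:
  assumes "ready R A" "r < n" "R rR = r" "R rE = last_entry r (hs m)" "A aRank = a"
  shows "wp W scatter_prog (\<lambda>_ R A. ready R A \<and> R rR = r \<and> A aRank = a \<and>
    (\<forall>h e. is_rank r h e \<longrightarrow> A aTmp h = e)) (5 * length (rl r) + 1) R A"
  unfolding scatter_prog_def
proof (rule wp_While[where Inv = "\<lambda>k R A. ready R A \<and> R rR = r \<and> A aRank = a \<and>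
    (R rE = 0 \<or> entry r (R rE)) \<and> (\<forall>h e. is_rank r h e \<and> R rE < e \<longrightarrow> A aTmp h = e) \<and>
    5 * entries_below r (Suc (R rE)) + 1 \<le> k"], goal_cases)
  case 1
  have "\<not> R rE < e" if "is_rank r h e" for h e
    using last_entry_ge[of r e "hs m"] entry_bounds[of r e] that assms(4)
    by (auto simp: entry_def not_less)
  then show ?case
    using assms last_entry_cases[of r "hs m"] entries_below_total[of r] entries_below_last[of r "hs m"]
    by auto
next
  case (3 k R A)
  then have "0 < R rE" by (simp add: ready_def base_def)
  then have "entry r (R rE)" using 3 by auto
  then obtain h where h: "is_rank r h (R rE)" by (auto simp: entry_def)
  then have A: "A aOwner (R rE) = h" "A aNext (R rE) = last_entry r (R rE)"
    using 3 entry_bounds[of r "R rE"] \<open>entry r (R rE)\<close> by (auto simp: ready_def linked_def)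
  have cnt: "entries_below r (Suc (R rE)) = entries_below r (Suc (last_entry r (R rE))) + 1"
    unfolding entries_below_last using \<open>entry r (R rE)\<close> by (simp add: entries_below_Suc)
  have tmp: "((A aTmp)(h := R rE)) h' = e"
    if e: "is_rank r h' e" "last_entry r (R rE) < e" for h' e
  proof (cases "h' = h")
    case True
    then show ?thesis using is_rank_unique[of r h e "R rE"] e(1) h by simp
  next
    case False
    then have "e \<noteq> R rE" using is_rank_hospital_unique[OF e(1), of r h] h by auto
    moreover have "R rE \<le> e" using last_entry_ge[of r e "R rE"] e by (force simp: entry_def not_less)
    ultimately show ?thesis using 3 e(1) False by auto
  qed
  show ?case
    using 3 A cnt tmp last_entry_cases[of r "R rE"]
    by (auto simp: ready_def base_def parsed_residents_def linked_def)
next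
  case (4 k R A)
  then have "R rE = 0" by (simp add: ready_def base_def)
  moreover have "0 < e" if "is_rank r h e" for h e
    using that not_entry_0[of r] by (cases e) (auto simp: entry_def)
  ultimately show ?case using 4 by auto
qed auto

lemma wp_gather:
  assumes "ready R A" "r < n" "R rR = r" "R rF = rs r" "R rU = re r" "ranked (rs r) (A aRank)"
    "\<forall>h e. is_rank r h e \<longrightarrow> A aTmp h = e"
  shows "wp W gather_prog (\<lambda>_ R A. ready R A \<and> R rR = r \<and> ranked (re r) (A aRank))
    (6 * length (rl r) + 1) R A"
  unfolding gather_prog_def
proof (rule wp_While[where Inv = "\<lambda>k R A. ready R A \<and> R rR = r \<and> R rU = re r \<and> rs r \<le> R rF \<and>
    R rF \<le> re r \<and> ranked (R rF) (A aRank) \<and> (\<forall>h e. is_rank r h e \<longrightarrow> A aTmp h = e) \<and>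
    6 * (re r - R rF) + 1 \<le> k"], goal_cases)
  case 1
  then show ?case using assms by (simp add: re_def)
next
  case (3 k R A)
  then have f: "rs r \<le> R rF" "R rF < re r" by auto
  have "A aTmp (inp (R rF)) = rank r (inp (R rF))"
    using 3 is_rank_rank resident_entry_edge[OF assms(2) f] by blast
  moreover have "re r \<le> W" using re_le_length[OF assms(2)] word by simp
  ultimately show ?case
    using 3 f ranked_Suc[OF _ f, of "A aRank"]
    by (auto simp: ready_def base_def parsed_residents_def linked_def)
qed auto

definition ranks_inv :: "nat \<Rightarrow> (nat \<Rightarrow> nat) \<Rightarrow> (nat \<Rightarrow> nat \<Rightarrow> nat) \<Rightarrow> bool" where
  "ranks_inv k R A \<longleftrightarrow> ready R A \<and> R rR \<le> n \<and> ranked (rs (R rR)) (A aRank) \<and>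
    12 * (rs n - rs (R rR)) + 1 \<le> k"

lemma wp_ranks:
  assumes "ready R A" "R rR = 0"
  shows "wp W ranks_prog (\<lambda>_ R A. ready R A \<and> ranked (rs n) (A aRank)) (12 * (rs n - rs 0) + 1) R A"
  unfolding ranks_prog_def
proof (rule wp_While[where Inv = ranks_inv], goal_cases)
  case 1
  have "ranked (rs 0) (A aRank)"
    unfolding ranked_def using rs_mono[OF le0] by (meson leD le_trans)
  then show ?case using assms by (simp add: ranks_inv_def)
next
  case (3 k R A)
  define r where "r = R rR"
  have inv: "ready R A" "ranked (rs r) (A aRank)" "12 * (rs n - rs r) + 1 \<le> k" "r < n"
    using 3 by (auto simp: r_def ranks_inv_def ready_def base_def)
  have rs: "rs r + length (rl r) + 1 \<le> rs n"
    using rs_mono[of "Suc r" n] inv(4) by (simp add: rs_Suc re_def)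
  have W: "n \<le> W" using word length_xs_ge by simp
  have G: "wp W gather_prog (wp W (block [Add rR rR rOne]) ranks_inv) k' R' A'"
    if "ready R' A'" "R' rR = r" "R' rF = rs r" "R' rU = re r" "ranked (rs r) (A' aRank)"
      "\<forall>h e. is_rank r h e \<longrightarrow> A' aTmp h = e"
      "12 * (rs n - rs r) \<le> k' + 5 * length (rl r) + 4" for k' R' A'
  proof (rule wp_conseq[OF wp_gather[OF that(1) inv(4) that(2-6)]])
    show "6 * length (rl r) + 1 \<le> k'" using that(7) rs by simp
    fix k'' R'' A''
    assume post: "ready R'' A'' \<and> R'' rR = r \<and> ranked (re r) (A'' aRank)"
      and k'': "k' \<le> k'' + (6 * length (rl r) + 1)"
    have "12 * (rs n - rs (Suc r)) + 3 \<le> k''"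
      using k'' that(7) rs by (simp add: rs_Suc re_def)
    then show "wp W (block [Add rR rR rOne]) ranks_inv k'' R'' A''"
      using post inv(4) W ranked_re
      by (auto simp: ranks_inv_def ready_def base_def rs_Suc)
  qed
  have S: "wp W scatter_prog (wp W (block [Load rF aPtr rR, Load rU aEnd rR, gather_prog,
     Add rR rR rOne]) ranks_inv) k' R' A'"
    if "ready R' A'" "R' rR = r" "R' rE = last_entry r (hs m)" "ranked (rs r) (A' aRank)"
      "12 * (rs n - rs r) \<le> k' + 1" for k' R' A'
  proof (rule wp_conseq[OF wp_scatter[OF that(1) inv(4) that(2,3) refl]])
    show "5 * length (rl r) + 1 \<le> k'" using that(5) rs by simp
    fix k'' R'' A''
    assume post: "ready R'' A'' \<and> R'' rR = r \<and> A'' aRank = A' aRank \<and>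
        (\<forall>h e. is_rank r h e \<longrightarrow> A'' aTmp h = e)"
      and k'': "k' \<le> k'' + (5 * length (rl r) + 1)"
    have p: "A'' aPtr r = rs r" "A'' aEnd r = re r"
      using post inv(4) by (auto simp: ready_def parsed_residents_def)
    show "wp W (block [Load rF aPtr rR, Load rU aEnd rR, gather_prog, Add rR rR rOne])
      ranks_inv k'' R'' A''"
      using post that(4,5) k'' p rs
      by simp (intro conjI G; (linarith | simp))
  qed
  have "A aHead r = last_entry r (hs m)" using inv(1) by (simp add: ready_def linked_def)
  then show ?case
    using inv r_def[symmetric] rs by simp (intro conjI S; (linarith | simp))
qed (auto simp: ranks_inv_def ready_def base_def)

definition main_base :: "(nat \<Rightarrow> nat) \<Rightarrow> (nat \<Rightarrow> nat \<Rightarrow> nat) \<Rightarrow> bool" where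
  "main_base R A \<longleftrightarrow> R rZero = 0 \<and> R rOne = 1 \<and> R rN = n \<and> R rLow = 2 \<and> R rUp = 2 + m \<and>
     R rBound = surplus_bound \<and> A aIn = inp \<and> (\<forall>r<n. A aEnd r = re r) \<and> ranked (rs n) (A aRank)"

definition main_inv :: "nat \<Rightarrow> (nat \<Rightarrow> nat) \<Rightarrow> (nat \<Rightarrow> nat \<Rightarrow> nat) \<Rightarrow> bool" where
  "main_inv k R A \<longleftrightarrow> main_base R A \<and>
     da_inv (R rI) (R rX) (R rSur) (A aPtr) (A aCut) (A aCount) (A aMatch) \<and>
     40 * potential (R rI) (A aPtr) (A aCut) + 1 \<le> k"

lemma wp_accept:
  assumes mb: "main_base R A"
    and g: "da_inv (R rI) (R rX) b (A aPtr) (A aCut) (A aCount) (A aMatch)" "R rI < n"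
    and x: "A aPtr (R rX) < re (R rX)"
    and h: "R rH = inp (A aPtr (R rX))" "rank (R rX) (R rH) < A aCut (R rH)"
    and regs: "R rD = A aCount (R rH)" "R rG = Suc (R rH)"
    and acc: "A aCount (R rH) < lquota I (R rH) \<and> R rSur = b \<or>
      lquota I (R rH) \<le> A aCount (R rH) \<and> A aCount (R rH) < uquota I (R rH) \<and>
      b < surplus_bound \<and> R rSur = Suc b"
    and k: "40 * potential (R rI) (A aPtr) (A aCut) \<le> k + 25"
  shows "wp W accept_prog (\<lambda>k. main_inv (k - 3)) k R A"
proof -
  note step = da_inv_accept[OF g x h acc]
  have pos: "1 \<le> potential (R rI) (A aPtr) (A aCut)" using step(2) by simp
  have "R rX < n" using da_invD(2)[OF g(1)] g(2) by simp
  then have "R rH < m"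
    using h(1) resident_entry_edge[OF _ da_invD(4)[OF g(1)] x] edges_bounds by auto
  then have "A aCount (R rH) = card {r. r < n \<and> A aMatch r = Suc (R rH)}"
    by (rule da_invD(11)[OF g(1)])
  also have "\<dots> \<le> card {..<n}" by (intro card_mono) auto
  finally have "A aCount (R rH) \<le> card {..<n}" .
  then have W: "Suc (A aCount (R rH)) \<le> W" "Suc (R rI) \<le> W"
    using word length_xs_ge g(2) by simp_all
  show ?thesis
    unfolding accept_prog_def next_prog_def
    using mb step regs W k pos by (auto simp: main_base_def main_inv_def)
qed

lemma wp_evict:
  assumes mb: "main_base R A"
    and g: "da_inv (R rI) (R rX) (R rSur) (A aPtr) (A aCut) (A aCount) (A aMatch)" "R rI < n"
    and x: "A aPtr (R rX) < re (R rX)"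
    and h: "R rH = inp (A aPtr (R rX))" "rank (R rX) (R rH) < A aCut (R rH)"
    and regs: "R rCut = A aCut (R rH)" "R rG = Suc (R rH)"
    and full: "lquota I (R rH) \<le> A aCount (R rH)"
      "uquota I (R rH) \<le> A aCount (R rH) \<or> surplus_bound \<le> R rSur"
    and k: "40 * potential (R rI) (A aPtr) (A aCut) \<le> k + 25"
  shows "wp W evict_prog (\<lambda>k. main_inv (k - 3)) k R A"
proof -
  note step = da_inv_evict[OF g x h full refl]
  have pos: "1 \<le> potential (R rI) (A aPtr) (A aCut)" using step(3) by simp
  show ?thesis
    unfolding evict_prog_def
    using mb step regs k pos by (auto simp: main_base_def main_inv_def)
qed

lemma wp_apply:
  assumes mb: "main_base R A"
    and g: "da_inv (R rI) (R rX) (R rSur) (A aPtr) (A aCut) (A aCount) (A aMatch)" "R rI < n"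
    and x: "A aPtr (R rX) < re (R rX)"
    and h: "R rH = inp (A aPtr (R rX))" "rank (R rX) (R rH) < A aCut (R rH)"
    and regs: "R rCut = A aCut (R rH)"
    and k: "40 * potential (R rI) (A aPtr) (A aCut) \<le> k + 8"
  shows "wp W apply_prog (\<lambda>k. main_inv (k - 2)) k R A"
proof -
  let ?h = "R rH" and ?d = "A aCount (R rH)"
  have xn: "R rX < n" using da_invD(2)[OF g(1)] g(2) by simp
  have hm: "?h < m"
    using h(1) resident_entry_edge[OF xn da_invD(4)[OF g(1) xn] x] edges_bounds by simp
  have W: "2 + 2 * m \<le> W" "n \<le> W" using word length_xs_ge by simp_all
  have pos: "1 \<le> potential (R rI) (A aPtr) (A aCut)" using g(2) by (simp add: potential_def)
  have sur: "R rSur < surplus_bound \<Longrightarrow> Suc (R rSur) \<le> W" using W(2) by (simp add: surplus_bound_def)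
  define R' where "R' = R(rD := ?d, rLq := lquota I ?h, rUq := uquota I ?h, rG := Suc ?h)"
  have lq: "inp (Suc (Suc ?h)) = lquota I ?h" and uq: "inp (Suc (Suc (m + ?h))) = uquota I ?h"
    using inp_lquota[OF hm] inp_uquota[OF hm] by simp_all
  have mb': "main_base R' A" using mb by (simp add: main_base_def R'_def)
  have same: "R' rI = R rI" "R' rX = R rX" "R' rSur = R rSur" "R' rH = R rH" "R' rCut = R rCut"
    "R' rD = ?d" "R' rG = Suc ?h" "R' rLq = lquota I ?h" "R' rUq = uquota I ?h"
    "R' rBound = surplus_bound" "R' rOne = 1"
    using mb by (simp_all add: R'_def main_base_def)
  have acc: "wp W accept_prog (wp W (block []) (\<lambda>k. main_inv (k - 2))) k' R' A"
    if "?d < lquota I ?h" "40 * potential (R rI) (A aPtr) (A aCut) \<le> k' + 20" for k'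
  proof (rule wp_mono)
    show "wp W accept_prog (\<lambda>k. main_inv (k - 3)) k' R' A"
      by (rule wp_accept[where b = "R rSur"]) (use mb' g x h that in \<open>simp_all add: same\<close>)
  qed (auto simp: main_inv_def)
  have acc': "wp W accept_prog (wp W (block []) (\<lambda>k. main_inv (k - 2))) k' (R'(rSur := Suc (R rSur))) A"
    if "lquota I ?h \<le> ?d" "?d < uquota I ?h" "R rSur < surplus_bound"
      "40 * potential (R rI) (A aPtr) (A aCut) \<le> k' + 20" for k'
  proof (rule wp_mono)
    show "wp W accept_prog (\<lambda>k. main_inv (k - 3)) k' (R'(rSur := Suc (R rSur))) A"
    proof (rule wp_accept[where b = "R rSur"])
      show "main_base (R'(rSur := Suc (R rSur))) A" using mb' by (simp add: main_base_def)
    qed (use g x h that in \<open>simp_all add: same\<close>)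
  qed (auto simp: main_inv_def)
  have ev: "wp W evict_prog (wp W (block []) (\<lambda>k. main_inv (k - 2))) k' R' A"
    if "lquota I ?h \<le> ?d" "uquota I ?h \<le> ?d \<or> surplus_bound \<le> R rSur"
      "40 * potential (R rI) (A aPtr) (A aCut) \<le> k' + 20" for k'
  proof (rule wp_mono)
    show "wp W evict_prog (\<lambda>k. main_inv (k - 3)) k' R' A"
      by (rule wp_evict) (use mb' g x h regs that in \<open>simp_all add: same\<close>)
  qed (auto simp: main_inv_def)
  note decide = arg_cong[OF decide_prog_def, of "\<lambda>p. wp W p _ _ _ _"]
  have branch: "wp W decide_prog (wp W (block []) (\<lambda>k. main_inv (k - 2))) k' R' A"
    if k': "40 * potential (R rI) (A aPtr) (A aCut) \<le> k' + 16" for k'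
  proof -
    consider "?d < lquota I ?h" | "lquota I ?h \<le> ?d" "?d < uquota I ?h" "R rSur < surplus_bound"
      | "lquota I ?h \<le> ?d" "?d < uquota I ?h" "surplus_bound \<le> R rSur"
      | "lquota I ?h \<le> ?d" "uquota I ?h \<le> ?d"
      by linarith
    then show ?thesis
    proof cases
      case 1
      then show ?thesis using k' pos by (simp add: same decide) (intro conjI acc; linarith)
    next
      case 2
      then show ?thesis using k' pos sur by (simp add: same decide) (intro conjI acc'; linarith)
    next
      case 3
      then have full: "uquota I ?h \<le> ?d \<or> surplus_bound \<le> R rSur" by simp
      show ?thesis using 3 k' pos by (simp add: same decide) (intro conjI ev full; linarith)
    next
      case 4
      then have full: "uquota I ?h \<le> ?d \<or> surplus_bound \<le> R rSur" by simp
      show ?thesis using 4 k' pos by (simp add: same decide) (intro conjI ev full; linarith)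
    qed
  qed
  show ?thesis
    unfolding apply_prog_def
    using mb hm W k pos lq uq
    by (simp add: main_base_def)
      (intro conjI branch[unfolded R'_def]; linarith)
qed

lemma wp_main:
  assumes "ready R A" "ranked (rs n) (A aRank)" "R rI = 0"
  shows "wp W main_prog (\<lambda>_ R A. \<exists>x b p k d. da_inv n x b p k d (A aMatch))
    (40 * (n + 2 * card (edges I)) + 1) R A"
  unfolding main_prog_def
proof (rule wp_While[where Inv = main_inv], goal_cases)
  case 1
  have "\<forall>r<n. A aPtr r = rs r" "\<forall>h<m. A aCut h = he h"
    using assms(1) by (auto simp: ready_def parsed_residents_def)
  then show ?case
    using assms da_inv_start potential_start
    by (simp add: main_inv_def main_base_def ready_def base_def parsed_residents_def)
next
  case (3 k R A)
  have mb: "main_base R A"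
    and g: "da_inv (R rI) (R rX) (R rSur) (A aPtr) (A aCut) (A aCount) (A aMatch)"
    and k: "40 * potential (R rI) (A aPtr) (A aCut) + 1 \<le> k"
    using 3 by (auto simp: main_inv_def)
  have i: "R rI < n" using 3 mb by (simp add: main_base_def)
  have x: "R rX < n" using da_invD(2)[OF g] i by simp
  have W: "n \<le> W" "2 + 2 * m \<le> W" using word length_xs_ge by simp_all
  have pos: "1 \<le> potential (R rI) (A aPtr) (A aCut)" using i by (simp add: potential_def)
  show ?case
  proof (cases "A aPtr (R rX) < re (R rX)")
    case False
    note step = da_inv_exhausted[OF g i False]
    show ?thesis
      unfolding next_prog_def
      using mb x step False k i W pos by (auto simp: main_base_def main_inv_def)
  next
    case True
    define f where "f = A aPtr (R rX)"
    define h where "h = inp f"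
    have f: "rs (R rX) \<le> f" "f < re (R rX)" using da_invD(4)[OF g x] True by (simp_all add: f_def)
    have edge: "(R rX, h) \<in> edges I" using resident_entry_edge[OF x f] by (simp add: h_def)
    have hm: "h < m" using edges_bounds[OF edge] by simp
    have rk: "A aRank f = rank (R rX) h"
      using mb x f re_less[of "R rX" n] by (simp add: main_base_def ranked_def h_def)
    have fW: "Suc f \<le> W" using f re_le_length[OF x] word by simp
    show ?thesis
    proof (cases "rank (R rX) h < A aCut h")
      case False
      have step: "da_inv (R rI) (R rX) (R rSur) ((A aPtr)(R rX := Suc f)) (A aCut) (A aCount) (A aMatch)"
        "potential (R rI) ((A aPtr)(R rX := Suc f)) (A aCut) < potential (R rI) (A aPtr) (A aCut)"
        using da_inv_advance[OF g i True] False by (simp_all add: f_def h_def)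
      show ?thesis
        using mb x step f k fW rk False pos f_def[symmetric] h_def[symmetric]
        by (simp add: main_base_def main_inv_def) (intro conjI; linarith)
    next
      case adm: True
      have "wp W apply_prog (\<lambda>k. main_inv (k - 2)) k' R' A"
        if "main_base R' A" "R' rI = R rI" "R' rX = R rX" "R' rSur = R rSur" "R' rH = h"
          "R' rCut = A aCut h" "40 * potential (R rI) (A aPtr) (A aCut) \<le> k' + 8" for k' R'
        using that g i True adm by (intro wp_apply) (simp_all add: h_def f_def)
      then have ap: "wp W apply_prog (wp W (block []) (wp W (block []) main_inv)) k' R' A"
        if "main_base R' A" "R' rI = R rI" "R' rX = R rX" "R' rSur = R rSur" "R' rH = h"
          "R' rCut = A aCut h" "40 * potential (R rI) (A aPtr) (A aCut) \<le> k' + 8" for k' R'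
        by (rule wp_mono) (use that in \<open>auto simp: main_inv_def\<close>)
      show ?thesis
        using mb x f k rk adm pos f_def[symmetric] h_def[symmetric]
        by (simp add: main_base_def)
          (intro conjI ap; (linarith | simp add: main_base_def))
    qed
  qed
next
  case (4 k R A)
  then have "da_inv (R rI) (R rX) (R rSur) (A aPtr) (A aCut) (A aCount) (A aMatch)" "\<not> R rI < n"
    by (auto simp: main_inv_def main_base_def)
  then have "da_inv n (R rX) (R rSur) (A aPtr) (A aCut) (A aCount) (A aMatch)"
    using da_invD(1) by (metis le_neq_implies_less)
  then show ?case by blast
qed (auto simp: main_inv_def)

lemma wp_cl_prog:
  "wp W cl_prog (\<lambda>_ R A. \<exists>x b p k d. da_inv n x b p k d (A aMatch)) (110 * (instance_size I + 1))
    (\<lambda>_. 0) (\<lambda>a. if a = 0 then inp else (\<lambda>_. 0))" (is "wp W cl_prog ?Q _ _ _")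
proof -
  let ?s = "card (edges I)"
  have sum: "(\<Sum>j<k. Suc (length (l j))) = k + (\<Sum>j<k. length (l j))"
    for k and l :: "nat \<Rightarrow> nat list"
    by (induction k) auto
  have lens: "hs m - hs 0 = m + ?s" "rs n - rs 0 = n + ?s"
    using sum_resident_lists sum_hospital_lists by (simp_all add: hs_def rs_def sum)
  have 1: "wp W (block [Const rI 0, main_prog]) ?Q k R A"
    if "ready R A" "ranked (rs n) (A aRank)" "40 * (n + 2 * ?s) + 3 \<le> k" for k R A
  proof -
    have "wp W main_prog (wp W (block []) ?Q) (k - 1) (R(rI := 0)) A"
      by (rule wp_conseq[OF wp_main]) (use that in auto)
    then show ?thesis using that(3) by simp
  qed
  have 2: "wp W (block [Const rR 0, ranks_prog, Const rI 0, main_prog]) ?Q k R A"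
    if "ready R A" "52 * n + 92 * ?s + 5 \<le> k" for k R A
  proof -
    have "wp W ranks_prog (wp W (block [Const rI 0, main_prog]) ?Q) (k - 1) (R(rR := 0)) A"
      by (rule wp_conseq[OF wp_ranks]) (use that in \<open>auto simp: lens simp del: wp_block intro!: 1\<close>)
    then show ?thesis using that(2) by simp
  qed
  have 3: "wp W (block [hospitals_prog, Const rR 0, ranks_prog, Const rI 0, main_prog]) ?Q k R A"
    if "base R A" "parsed_residents n A" "Suc (R rCur) = hs 0" "R rBound = n" "R rH = 0"
      "A aHead = (\<lambda>_. 0)" "52 * n + 12 * m + 104 * ?s + 6 \<le> k" for k R A
  proof -
    have "wp W hospitals_prog (wp W (block [Const rR 0, ranks_prog, Const rI 0, main_prog]) ?Q) k R A"
      by (rule wp_conseq[OF wp_hospitals[OF that(1-6)]])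
        (use that(7) in \<open>auto simp: lens ready_def simp del: wp_block intro!: 2\<close>)
    then show ?thesis by simp
  qed
  have 4: "wp W (block [residents_prog, hospitals_prog, Const rR 0, ranks_prog, Const rI 0, main_prog]) ?Q k R A"
    if "base R A" "R rCur = 2 * m + 2" "R rBound = n" "R rI = 0" "R rH = 0"
      "A aHead = (\<lambda>_. 0)" "60 * n + 12 * m + 104 * ?s + 7 \<le> k" for k R A
  proof -
    have "wp W residents_prog
        (wp W (block [hospitals_prog, Const rR 0, ranks_prog, Const rI 0, main_prog]) ?Q) k R A"
      by (rule wp_conseq[OF wp_residents[OF that(1-6)]]) (use that(7) in \<open>simp_all add: 3 hs_0 del: wp_block\<close>)
    then show ?thesis by simp
  qed
  have "wp W init_prog (wp W (block [residents_prog, hospitals_prog, Const rR 0, ranks_prog,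
      Const rI 0, main_prog]) ?Q) (110 * (instance_size I + 1))
      (\<lambda>_. 0) (\<lambda>a. if a = 0 then inp else (\<lambda>_. 0))"
    by (rule wp_conseq[OF wp_init[OF refl refl]])
      (simp_all add: instance_size_eq 4 del: wp_block)
  then show ?thesis unfolding cl_prog_def by simp
qed

end

theorem theorem2:
  "\<exists>(p :: com) (c :: nat). \<forall>(I :: (nat, nat) hrlq) xs.
     hrlq_instance I \<and> CL_restricted I \<and>
     (\<exists>M. is_matching I M \<and> is_feasible I M) \<and> encodes xs I \<longrightarrow>
     (\<exists>M. computes_within c p I xs M \<and>
          feasible_ef_matching I M \<and>
          (\<forall>M'. feasible_ef_matching I M' \<longrightarrow> card M' \<le> card M) \<and>
          (\<forall>M'. feasible_ef_matching I M' \<longrightarrow>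
             card (unmatched I M) \<le> card (unmatched I M')))"
proof (intro exI[of _ cl_prog] exI[of _ "110 :: nat"] allI impI)
  fix I :: "(nat, nat) hrlq" and xs
  assume *: "hrlq_instance I \<and> CL_restricted I \<and>
     (\<exists>M. is_matching I M \<and> is_feasible I M) \<and> encodes xs I"
  then obtain n m rl hl where enc: "encoded I xs n m rl hl"
    unfolding encodes_def encoded_def by blast
  interpret encoded I xs n m rl hl by (rule enc)
  define W where "W = 110 * (instance_size I + Max (set xs) + 1)"
  interpret encoded_word I xs n m rl hl W
    by unfold_locales (use length_xs_le in \<open>simp add: W_def\<close>)
  have state: "input_state xs = ((\<lambda>_. 0), (\<lambda>a. if a = 0 then inp else (\<lambda>_. 0)))"
    by (auto simp: input_state_def inp_def fun_eq_iff)
  from wp_cl_prog obtain t R A x b p k d where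
    run: "exec W cl_prog (input_state xs) t (R, A)" "t \<le> 110 * (instance_size I + 1)"
    and g: "da_inv n x b p k d (A 1)"
    unfolding wp_def state by blast
  define M where "M = output_matching I (R, A)"
  have M: "M = {(r, h). r < n \<and> A 1 r = Suc h}"
    by (simp add: M_def output_matching_def residents)
  have ef: "feasible_ef_matching I M" unfolding M by (rule da_inv_final(1)[OF g])
  have sub: "fst ` M' \<subseteq> fst ` M" if "feasible_ef_matching I M'" for M'
    unfolding M by (rule da_inv_final(2)[OF g that])
  have finM: "finite (fst ` M)" using M by (auto intro: finite_subset[of _ "{..<n}"])
  have "card M' \<le> card M" if "feasible_ef_matching I M'" for M'
    using card_mono[OF finM sub[OF that]] that ef card_fst_matching
    unfolding feasible_ef_matching_def by metis
  moreover have "card (unmatched I M) \<le> card (unmatched I M')" if "feasible_ef_matching I M'" for M'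
    using sub[OF that] by (intro card_mono) (auto simp: unmatched_def residents partner_eq_None)
  moreover have "computes_within 110 cl_prog I xs M"
    unfolding computes_within_def using run M_def W_def by blast
  ultimately show "\<exists>M. computes_within 110 cl_prog I xs M \<and> feasible_ef_matching I M \<and>
      (\<forall>M'. feasible_ef_matching I M' \<longrightarrow> card M' \<le> card M) \<and>
      (\<forall>M'. feasible_ef_matching I M' \<longrightarrow> card (unmatched I M) \<le> card (unmatched I M'))"
    using ef by blast
qed

end
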